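(* There is an algorithm which, given a simple hierarchical specification $\Gamma=(G_1,\dots,G_n)$ with vertex number $N$ and edge number $M$, runs in time $O(N+M)$ and computes a partition $(V_1,V_2)$ of the vertex set of $E(\Gamma)$, represented by a hierarchical specification of $V_1$ of size $O(N)$, together with the number $E$ of edges of $E(\Gamma)$ (parallel edges counted separately) having one endpoint in $V_1$ and the other in $V_2$, such that the maximum number of edges of $E(\Gamma)$ crossing any cut is at most $2E$.
   Context: A hierarchical specification $\Gamma=(G_1,\dots,G_n)$ is a sequence of undirected simple graphs $G_i$ (cells); $G_i$ has $n_i$ vertices and $m_i$ edges. Some vertices of $G_i$ are designated pins, numbered $1,\dots,p_i$; the others are inner vertices, some of which are designated nonterminals. Each nonterminal $v$ of $G_i$ has a type $G_j$ with $j<i$; all neighbours of $v$ are non-nonterminal vertices, in one-to-one correspondence with the pins of $G_j$. The expansion is defined by $E(\Gamma_1)=G_1$ and, for $i>1$, $E(\Gamma_i)$ is obtained from $G_i$ by deleting every nonterminal $v$ (of type $G_j$) with its incident edges and inserting a copy of $E(\Gamma_j)$, identifying its $l$-th pin with the neighbour of $v$ corresponding to pin $l$; $\Gamma_i=(G_1,\dots,G_i)$ and $E(\Gamma)=E(\Gamma_n)$ (possibly a multigraph). $N=\sum_i n_i$, $M=\sum_i m_i$. $\Gamma$ is simple if no cell contains an edge between two of its pins. *)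

theory Defs
  imports Complex_Main "HOL-Library.Multiset"
begin

section \<open>Hierarchical specifications\<close>

text \<open>
  A cell is given by listings of its vertices, of its edges (each undirected edge is listed once,
  in an arbitrary orientation), of its pins (pin number \<open>l + 1\<close> is \<open>pins C ! l\<close>) and of its
  nonterminals.  An entry \<open>(x, j, ns)\<close> of the latter says that \<open>x\<close> is a nonterminal of type
  \<open>\<Gamma> ! j\<close> whose neighbour corresponding to the \<open>l\<close>-th pin of \<open>\<Gamma> ! j\<close> is \<open>ns ! l\<close>.
  The edges between a nonterminal and its neighbours also belong to \<open>edges C\<close>.
  Cells of a specification are indexed from 0.
\<close>

record cell =
  verts :: "nat list"
  edges :: "(nat \<times> nat) list"
  pins  :: "nat list"
  nonts :: "(nat \<times> nat \<times> nat list) list"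

type_synonym spec = "cell list"

definition nonterminals :: "cell \<Rightarrow> nat set" where
  "nonterminals C = fst ` set (nonts C)"

definition terminals :: "cell \<Rightarrow> nat set" where
  "terminals C = set (verts C) - nonterminals C"

definition neighbours :: "cell \<Rightarrow> nat \<Rightarrow> nat set" where
  "neighbours C v = {u. (u, v) \<in> set (edges C) \<or> (v, u) \<in> set (edges C)}"

text \<open>Graphs have at least one vertex; hence a specification has at most as many cells as
  vertices, and the number of cells need not appear in bounds such as \<open>O(N + M)\<close>.\<close>

definition simple_graph :: "cell \<Rightarrow> bool" where
  "simple_graph C \<longleftrightarrow>
     verts C \<noteq> [] \<and> distinct (verts C) \<and>
     (\<forall>(u, v)\<in>set (edges C). u \<in> set (verts C) \<and> v \<in> set (verts C) \<and> u \<noteq> v) \<and>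
     distinct (map (\<lambda>(u, v). {u, v}) (edges C))"

definition hier_spec :: "spec \<Rightarrow> bool" where
  "hier_spec \<Gamma> \<longleftrightarrow> \<Gamma> \<noteq> [] \<and>
     (\<forall>i<length \<Gamma>. let C = \<Gamma> ! i in
        simple_graph C \<and>
        distinct (pins C) \<and> set (pins C) \<subseteq> set (verts C) \<and>
        distinct (map fst (nonts C)) \<and> nonterminals C \<subseteq> set (verts C) - set (pins C) \<and>
        (\<forall>(x, j, ns)\<in>set (nonts C).
           j < i \<and> distinct ns \<and> length ns = length (pins (\<Gamma> ! j)) \<and>
           set ns = neighbours C x \<and> set ns \<subseteq> terminals C))"

definition simple_spec :: "spec \<Rightarrow> bool" where
  "simple_spec \<Gamma> \<longleftrightarrow>
     (\<forall>C\<in>set \<Gamma>. \<forall>(u, v)\<in>set (edges C). \<not> (u \<in> set (pins C) \<and> v \<in> set (pins C)))"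

definition vertex_number :: "spec \<Rightarrow> nat" where
  "vertex_number \<Gamma> = (\<Sum>C\<leftarrow>\<Gamma>. length (verts C))"

definition edge_number :: "spec \<Rightarrow> nat" where
  "edge_number \<Gamma> = (\<Sum>C\<leftarrow>\<Gamma>. length (edges C))"


section \<open>Expansion\<close>

text \<open>
  A vertex of an expansion is a pair \<open>(\<pi>, v)\<close>: \<open>\<pi>\<close> is the sequence of nonterminals that leads
  from the outermost cell to the copy of a cell in which the vertex is created, and \<open>v\<close> is a
  terminal of that cell.  \<open>graft x ps ns\<close> renames the vertices of the copy that replaces the
  nonterminal \<open>x\<close>: the pins \<open>ps\<close> become the neighbours \<open>ns\<close> of \<open>x\<close>, all others become new.
\<close>

type_synonym xvertex = "nat list \<times> nat"

fun graft :: "nat \<Rightarrow> nat list \<Rightarrow> nat list \<Rightarrow> xvertex \<Rightarrow> xvertex" where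
  "graft x ps ns (\<pi>, v) =
     (if \<pi> = [] \<and> v \<in> set ps then ([], the (map_of (zip ps ns) v)) else (x # \<pi>, v))"

text \<open>
  Vertex set and multiset of edges of the expansion of the prefix of \<open>\<Gamma>\<close> that ends with cell \<open>i\<close>.
  The test \<open>j < i\<close> always succeeds for a hierarchical specification; it only serves termination.
\<close>

fun verts_upto :: "spec \<Rightarrow> nat \<Rightarrow> xvertex set" where
  "verts_upto \<Gamma> i =
     Pair [] ` terminals (\<Gamma> ! i) \<union>
     (\<Union>(x, j, ns)\<in>set (nonts (\<Gamma> ! i)).
        if j < i then graft x (pins (\<Gamma> ! j)) ns ` verts_upto \<Gamma> j else {})"

fun edges_upto :: "spec \<Rightarrow> nat \<Rightarrow> xvertex set multiset" where
  "edges_upto \<Gamma> i =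
     mset (map (\<lambda>(u, v). {([], u), ([], v)})
       (filter (\<lambda>(u, v). u \<in> terminals (\<Gamma> ! i) \<and> v \<in> terminals (\<Gamma> ! i)) (edges (\<Gamma> ! i)))) +
     (\<Sum>(x, j, ns)\<leftarrow>nonts (\<Gamma> ! i).
        if j < i then image_mset (image (graft x (pins (\<Gamma> ! j)) ns)) (edges_upto \<Gamma> j) else {#})"

declare verts_upto.simps [simp del] edges_upto.simps [simp del]

definition expansion_verts :: "spec \<Rightarrow> xvertex set" where
  "expansion_verts \<Gamma> = verts_upto \<Gamma> (length \<Gamma> - 1)"

definition expansion_edges :: "spec \<Rightarrow> xvertex set multiset" where
  "expansion_edges \<Gamma> = edges_upto \<Gamma> (length \<Gamma> - 1)"


section \<open>Cuts\<close>

definition crossing :: "'a set multiset \<Rightarrow> 'a set \<Rightarrow> 'a set \<Rightarrow> nat" where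
  "crossing Es V\<^sub>1 V\<^sub>2 = size {#e \<in># Es. \<exists>u\<in>V\<^sub>1. \<exists>v\<in>V\<^sub>2. e = {u, v}#}"

definition max_cut :: "'a set \<Rightarrow> 'a set multiset \<Rightarrow> nat" where
  "max_cut V Es = Max {crossing Es S (V - S) | S. S \<subseteq> V}"


section \<open>Random access machine\<close>

text \<open>
  Algorithms are programs of a random access machine with a read-once input tape, an append-only
  output tape, registers, and arrays with indirect addressing.  The names of registers and arrays
  are fixed in the program text, so that only finitely many of them occur (the arrays could be
  interleaved in one memory).  All cells hold natural numbers and are initially 0; \<open>Minus\<close> is
  truncated at 0.  Reading beyond the end of the input yields 0.

  Time is measured by the uniform cost criterion.  This is needed because the number of cut edges
  can be exponential in the size of the specification.  As customary with uniform cost, there is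
  no multiplication, so that a step increases the length of the numbers by at most one bit.
\<close>

datatype expr =
    Num nat
  | Reg nat
  | Arr nat expr
  | Plus expr expr
  | Minus expr expr

datatype prog =
    Assign nat expr
  | Store nat expr expr
  | Read nat
  | Write expr
  | Seq prog prog
  | Cond expr prog prog
  | While expr prog

record state =
  regs :: "nat \<Rightarrow> nat"
  arrs :: "nat \<Rightarrow> nat \<Rightarrow> nat"
  inp  :: "nat list"
  outp :: "nat list"

fun val :: "expr \<Rightarrow> state \<Rightarrow> nat" where
  "val (Num k) s = k"
| "val (Reg r) s = regs s r"
| "val (Arr a e) s = arrs s a (val e s)"
| "val (Plus e e') s = val e s + val e' s"
| "val (Minus e e') s = val e s - val e' s"

fun cost :: "expr \<Rightarrow> nat" where
  "cost (Num k) = 1"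
| "cost (Reg r) = 1"
| "cost (Arr a e) = cost e + 1"
| "cost (Plus e e') = cost e + cost e' + 1"
| "cost (Minus e e') = cost e + cost e' + 1"

text \<open>\<open>exec p s t s'\<close>: started in \<open>s\<close>, the program \<open>p\<close> halts after \<open>t\<close> steps in \<open>s'\<close>.
  Conditions are true if and only if their value is not 0.\<close>

inductive exec :: "prog \<Rightarrow> state \<Rightarrow> nat \<Rightarrow> state \<Rightarrow> bool" where
  Assign: "exec (Assign r e) s (cost e + 1) (s\<lparr>regs := (regs s)(r := val e s)\<rparr>)"
| Store: "exec (Store a e e') s (cost e + cost e' + 1)
     (s\<lparr>arrs := (arrs s)(a := (arrs s a)(val e s := val e' s))\<rparr>)"
| Read: "exec (Read r) s 1
     (s\<lparr>regs := (regs s)(r := (case inp s of [] \<Rightarrow> 0 | k # _ \<Rightarrow> k)), inp := tl (inp s)\<rparr>)"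
| Write: "exec (Write e) s (cost e + 1) (s\<lparr>outp := outp s @ [val e s]\<rparr>)"
| Seq: "exec p s t s' \<Longrightarrow> exec q s' t' s'' \<Longrightarrow> exec (Seq p q) s (t + t') s''"
| CondTrue: "val e s \<noteq> 0 \<Longrightarrow> exec p s t s' \<Longrightarrow> exec (Cond e p q) s (cost e + 1 + t) s'"
| CondFalse: "val e s = 0 \<Longrightarrow> exec q s t s' \<Longrightarrow> exec (Cond e p q) s (cost e + 1 + t) s'"
| WhileFalse: "val e s = 0 \<Longrightarrow> exec (While e p) s (cost e + 1) s"
| WhileTrue: "val e s \<noteq> 0 \<Longrightarrow> exec p s t s' \<Longrightarrow> exec (While e p) s' t' s'' \<Longrightarrow>
     exec (While e p) s (cost e + 1 + t + t') s''"

lemma exec_deterministic: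
  "exec p s t s' \<Longrightarrow> exec p s u s'' \<Longrightarrow> u = t \<and> s'' = s'"
proof (induction arbitrary: u s'' rule: exec.induct)
  case (Seq p s t s' q t' s1)
  from Seq.prems show ?case by cases (use Seq.IH in blast)
next
  case (CondTrue e s p t s' q)
  from CondTrue.prems CondTrue.hyps(1) show ?case by cases (use CondTrue.IH in blast)+
next
  case (CondFalse e s q t s' p)
  from CondFalse.prems CondFalse.hyps(1) show ?case by cases (use CondFalse.IH in blast)+
next
  case (WhileTrue e s p t s' t' s1)
  from WhileTrue.prems WhileTrue.hyps(1) show ?case by cases (use WhileTrue.IH in blast)+
qed (erule exec.cases; simp)+

definition initial :: "nat list \<Rightarrow> state" where
  "initial xs = \<lparr>regs = (\<lambda>_. 0), arrs = (\<lambda>_ _. 0), inp = xs, outp = []\<rparr>"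

definition computes :: "prog \<Rightarrow> nat list \<Rightarrow> nat \<Rightarrow> nat list \<Rightarrow> bool" where
  "computes p xs t ys \<longleftrightarrow> (\<exists>s. exec p (initial xs) t s \<and> outp s = ys)"

text \<open>Every list is preceded by its length, which makes the encoding of specifications
  uniquely decodable.\<close>

definition encode_list :: "('a \<Rightarrow> nat list) \<Rightarrow> 'a list \<Rightarrow> nat list" where
  "encode_list f xs = length xs # concat (map f xs)"

definition encode_cell :: "cell \<Rightarrow> nat list" where
  "encode_cell C =
     encode_list (\<lambda>v. [v]) (verts C) @
     encode_list (\<lambda>(u, v). [u, v]) (edges C) @
     encode_list (\<lambda>v. [v]) (pins C) @
     encode_list (\<lambda>(x, j, ns). x # j # encode_list (\<lambda>v. [v]) ns) (nonts C)"

definition encode_spec :: "spec \<Rightarrow> nat list" where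
  "encode_spec \<Gamma> = encode_list encode_cell \<Gamma>"

lemma encode_list_decodable:
  assumes f: "\<And>x y us vs. f x @ us = f y @ vs \<Longrightarrow> x = y \<and> us = vs"
    and eq: "encode_list f xs @ us = encode_list f ys @ vs"
  shows "xs = ys \<and> us = vs"
proof -
  from eq have "length xs = length ys" "concat (map f xs) @ us = concat (map f ys) @ vs"
    by (simp_all add: encode_list_def)
  then show ?thesis
  proof (induction rule: list_induct2)
    case (Cons x xs y ys)
    then have "x = y \<and> concat (map f xs) @ us = concat (map f ys) @ vs" by (intro f) simp
    with Cons.IH show ?case by simp
  qed simp
qed

lemma encode_cell_decodable:
  assumes "encode_cell C @ us = encode_cell D @ vs"
  shows "C = D \<and> us = vs"
proof -
  have single: "xs = ys \<and> us = vs"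
    if "encode_list (\<lambda>v. [v]) xs @ us = encode_list (\<lambda>v. [v]) ys @ vs" for xs ys us vs
    by (rule encode_list_decodable[OF _ that]) simp
  have pair: "xs = ys \<and> us = vs"
    if "encode_list (\<lambda>(u, v). [u, v]) xs @ us = encode_list (\<lambda>(u, v). [u, v]) ys @ vs"
    for xs ys us vs
    by (rule encode_list_decodable[OF _ that]) auto
  have nont: "xs = ys \<and> us = vs"
    if "encode_list (\<lambda>(x, j, ns). x # j # encode_list (\<lambda>v. [v]) ns) xs @ us =
        encode_list (\<lambda>(x, j, ns). x # j # encode_list (\<lambda>v. [v]) ns) ys @ vs" for xs ys us vs
    by (rule encode_list_decodable[OF _ that]) (auto dest: single)
  from assms have 1: "verts C = verts D"
    and 2: "encode_list (\<lambda>(u, v). [u, v]) (edges C) @ encode_list (\<lambda>v. [v]) (pins C) @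
      encode_list (\<lambda>(x, j, ns). x # j # encode_list (\<lambda>v. [v]) ns) (nonts C) @ us =
      encode_list (\<lambda>(u, v). [u, v]) (edges D) @ encode_list (\<lambda>v. [v]) (pins D) @
      encode_list (\<lambda>(x, j, ns). x # j # encode_list (\<lambda>v. [v]) ns) (nonts D) @ vs"
    unfolding encode_cell_def append_assoc by (blast dest: single)+
  from pair[OF 2] have 3: "edges C = edges D" and 4: "encode_list (\<lambda>v. [v]) (pins C) @
      encode_list (\<lambda>(x, j, ns). x # j # encode_list (\<lambda>v. [v]) ns) (nonts C) @ us =
      encode_list (\<lambda>v. [v]) (pins D) @
      encode_list (\<lambda>(x, j, ns). x # j # encode_list (\<lambda>v. [v]) ns) (nonts D) @ vs" by auto
  from single[OF 4] have 5: "pins C = pins D"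
    and 6: "encode_list (\<lambda>(x, j, ns). x # j # encode_list (\<lambda>v. [v]) ns) (nonts C) @ us =
      encode_list (\<lambda>(x, j, ns). x # j # encode_list (\<lambda>v. [v]) ns) (nonts D) @ vs" by auto
  from nont[OF 6] 1 3 5 show ?thesis by simp
qed

lemma encode_spec_decodable:
  "encode_spec \<Gamma> @ us = encode_spec \<Delta> @ vs \<Longrightarrow> \<Gamma> = \<Delta> \<and> us = vs"
  unfolding encode_spec_def by (rule encode_list_decodable[OF encode_cell_decodable])

end

theory Submission
  imports Defs
begin

text \<open>
  The cells are processed in their given order, and the inner terminals of a cell are coloured
  greedily: each vertex receives the colour that cuts at least half of the edges leading to
  vertices that already have a colour.  For this it suffices to know, for every pin of every
  earlier cell, how many of its edges in the expansion of that cell lead to each of the two colour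
  classes.  As no cell has edges between its pins, an edge of the expansion is decided exactly once,
  namely when its second endpoint is coloured, and thus at least half of all edges are cut.
  All copies of a cell are coloured alike, so \<open>V\<^sub>1\<close> is described by the specification that keeps
  only the chosen terminals and the nonterminals of each cell and has neither pins nor edges.
\<close>

section \<open>Greedy colouring\<close>

text \<open>A cell is coloured before the pins of any of its copies have colours, yet at least half
  of the edges must be cut in the end. Hence edges are counted for all colourings of the open pins
  at once, and twice: the bichromatic ones, whose decided part is \<open>E\<close>, and the
  monochromatic ones, whose decided part is some \<open>U\<close>. The program never computes
  \<open>U\<close>; it only matters that \<open>U \<le> E\<close> survives every greedy step. In the
  last cell no pin is open, so \<open>E + U \<le> 2 * E\<close> is the number of all edges, which
  bounds the optimum. A second obstacle is that graphs are nonempty, so a cell that contributes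
  nothing to \<open>V\<^sub>1\<close> cannot become an empty cell, and nonterminals of such a type
  have to go. Ties are broken in favour of \<open>V\<^sub>1\<close>; thus these cells have no inner
  terminals, from which it follows that the last cell is not among them. Linear time rests on
  addressing arrays directly by vertex names and on charging the neighbour lists of nonterminals to
  the edges incident with them.\<close>

fun adj :: "(nat \<times> nat) list \<Rightarrow> nat \<Rightarrow> nat list" where
  "adj [] v = []"
| "adj ((a, b) # es) v =
     (if v = b then [a] else []) @ (if v = a then [b] else []) @ adj es v"

text \<open>
  A state \<open>(S, A, E)\<close> consists of the vertices chosen for \<open>V\<^sub>1\<close>, the numbers \<open>A True v\<close> and
  \<open>A False v\<close> of edges that lead from \<open>v\<close> to \<open>V\<^sub>1\<close> and \<open>V\<^sub>2\<close>, and the number of cut edges.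
  Only edges with a coloured endpoint are taken into account.
\<close>

fun greedy_step ::
    "(nat \<Rightarrow> nat list) \<Rightarrow> nat \<Rightarrow> nat list \<times> (bool \<Rightarrow> nat \<Rightarrow> nat) \<times> nat \<Rightarrow>
     nat list \<times> (bool \<Rightarrow> nat \<Rightarrow> nat) \<times> nat" where
  "greedy_step nb u (S, A, E) =
     (let c = (A True u \<le> A False u)
      in (if c then S @ [u] else S, A(c := \<lambda>w. A c w + count_list (nb u) w), E + A (\<not> c) u))"

text \<open>
  The edges within \<open>R\<close> and from \<open>R\<close> to coloured vertices that the colouring \<open>l\<close> makes
  bichromatic (\<open>b = True\<close>) or monochromatic (\<open>b = False\<close>).  Colouring a vertex of \<open>R\<close> moves its
  contribution to the number of edges that are decided, which is larger for \<open>b = True\<close>.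
\<close>

definition weight ::
    "(nat \<times> nat) list \<Rightarrow> bool \<Rightarrow> (nat \<Rightarrow> bool) \<Rightarrow> nat set \<Rightarrow> (bool \<Rightarrow> nat \<Rightarrow> nat) \<Rightarrow> nat" where
  "weight es b l R A =
     (\<Sum>v\<in>R. A (l v \<noteq> b) v) +
     length (filter (\<lambda>(x, y). x \<in> R \<and> y \<in> R \<and> (l x \<noteq> l y) = b) es)"

text \<open>Without loops, an edge within \<open>insert u R\<close> that is not within
  \<open>R\<close> joins \<open>u\<close> to some \<open>w\<close> in \<open>R\<close>, and
  \<open>adj\<close> lists it once at \<open>u\<close>. The condition
  \<open>(l w \<noteq> b) = l u\<close> is \<open>(l u \<noteq> l w) = b\<close>, in the form in
  which \<open>weight\<close> selects an entry of \<open>A\<close>.\<close>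

lemma edges_insert:
  assumes "finite R" "u \<notin> R" "\<forall>(x, y)\<in>set es. x \<noteq> y"
  shows "length (filter (\<lambda>(x, y). x \<in> insert u R \<and> y \<in> insert u R \<and> (l x \<noteq> l y) = b) es) =
    (\<Sum>w\<in>R. if (l w \<noteq> b) = l u then count_list (adj es u) w else 0) +
    length (filter (\<lambda>(x, y). x \<in> R \<and> y \<in> R \<and> (l x \<noteq> l y) = b) es)"
  using assms(3)
proof (induction es)
  case (Cons e es)
  obtain x y where e: "e = (x, y)" by fastforce
  let ?h = "\<lambda>w. if (l w \<noteq> b) = l u then count_list (adj es u) w else 0"
  let ?g = "\<lambda>z w. if (l w \<noteq> b) = l u \<and> w = z then 1 else (0::nat)"
  have "(\<Sum>w\<in>R. if (l w \<noteq> b) = l u then count_list (adj (e # es) u) w else 0) =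
      (\<Sum>w\<in>R. (if u = y then ?g x w else 0) + (if u = x then ?g y w else 0) + ?h w)"
    by (rule sum.cong) (auto simp: e)
  also have "\<dots> = (if u = y then (\<Sum>w\<in>R. ?g x w) else 0) +
      (if u = x then (\<Sum>w\<in>R. ?g y w) else 0) + sum ?h R"
    by (simp add: sum.distrib)
  also have "(\<Sum>w\<in>R. ?g x w) = (if x \<in> R \<and> (l x \<noteq> b) = l u then 1 else 0)"
    using assms(1) by (subst sum.cong[OF refl, of _ _ "\<lambda>w. if x = w then ?g x x else 0"]) (auto simp: sum.delta)
  also have "(\<Sum>w\<in>R. ?g y w) = (if y \<in> R \<and> (l y \<noteq> b) = l u then 1 else 0)"
    using assms(1) by (subst sum.cong[OF refl, of _ _ "\<lambda>w. if y = w then ?g y y else 0"]) (auto simp: sum.delta)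
  finally have "(\<Sum>w\<in>R. if (l w \<noteq> b) = l u then count_list (adj (e # es) u) w else 0) =
      (if u = y then (if x \<in> R \<and> (l x \<noteq> b) = l u then 1 else 0) else 0) +
      (if u = x then (if y \<in> R \<and> (l y \<noteq> b) = l u then 1 else 0) else 0) + sum ?h R" .
  with Cons show ?case using assms(2) by (auto simp: e)
qed (simp cong: if_cong)

text \<open>Colouring \<open>u\<close> releases its edges to coloured vertices,
  \<open>A (c \<noteq> b) u\<close>. Its edges into \<open>R\<close> pass from the second summand of
  \<open>weight\<close> to the first, where the update of \<open>A\<close> at colour
  \<open>c\<close> records them.\<close>

lemma weight_insert:
  assumes "finite R" "u \<notin> R" "\<forall>(x, y)\<in>set es. x \<noteq> y" "l u = c"
  shows "weight es b l (insert u R) A =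
    A (c \<noteq> b) u + weight es b l R (A(c := \<lambda>w. A c w + count_list (adj es u) w))"
proof -
  have "(\<Sum>w\<in>R. (A(c := \<lambda>w. A c w + count_list (adj es u) w)) (l w \<noteq> b) w) =
      (\<Sum>w\<in>R. A (l w \<noteq> b) w) + (\<Sum>w\<in>R. if (l w \<noteq> b) = l u then count_list (adj es u) w else 0)"
    by (subst sum.distrib[symmetric], rule sum.cong) (auto simp: assms(4))
  then show ?thesis
    using assms edges_insert[OF assms(1,2,3), of l b] by (simp add: weight_def)
qed

text \<open>Decided edges plus \<open>weight\<close> stay constant, for each \<open>b\<close> and
  every labelling that agrees with the result on \<open>us\<close>. On \<open>R\<close> the
  labelling is arbitrary, since this will be the set of pins whose colours come later.
  \<open>U\<close> is a ghost value, the monochromatic counterpart of \<open>E\<close>;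
  \<open>U'\<close> is chosen before \<open>b\<close> and \<open>l\<close>.\<close>

lemma greedy_weight:
  assumes "fold (greedy_step (adj es)) us (S, A, E) = (S', A', E')"
    and "distinct us" "set us \<inter> R = {}" "set us \<inter> set S = {}" "finite R"
    and "\<forall>(x, y)\<in>set es. x \<noteq> y" "U \<le> E"
  shows "set S \<subseteq> set S' \<and> set S' \<subseteq> set S \<union> set us \<and> (\<exists>U'\<le>E'. \<forall>b l.
    (\<forall>u\<in>set us. l u = (u \<in> set S')) \<longrightarrow>
    (if b then E else U) + weight es b l (set us \<union> R) A = (if b then E' else U') + weight es b l R A')"
  using assms(1,2,3,4,7)
proof (induction us arbitrary: S A E U)
  case Nil
  then show ?case by auto
next
  case (Cons u us)
  define c where "c = (A True u \<le> A False u)"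
  let ?A = "A(c := \<lambda>w. A c w + count_list (adj es u) w)"
  let ?S = "if c then S @ [u] else S"
  have fold: "fold (greedy_step (adj es)) us (?S, ?A, E + A (\<not> c) u) = (S', A', E')"
    using Cons.prems(1) by (simp add: c_def Let_def)
  \<comment> \<open>At most as many edges of \<open>u\<close> lead to its own colour
    \<open>c\<close> as to the opposite one, so the monochromatic gain does not exceed the cut
    gain.\<close>
  have "U + A c u \<le> E + A (\<not> c) u"
    using Cons.prems(5) by (cases c) (auto simp: c_def)
  moreover have "set us \<inter> set ?S = {}" "distinct us" "set us \<inter> R = {}"
    using Cons.prems by auto
  ultimately obtain U' where sub: "set ?S \<subseteq> set S'" "set S' \<subseteq> set ?S \<union> set us" and U': "U' \<le> E'"
    and eq: "\<And>b l. \<forall>u\<in>set us. l u = (u \<in> set S') \<Longrightarrow>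
      (if b then E + A (\<not> c) u else U + A c u) + weight es b l (set us \<union> R) ?A =
      (if b then E' else U') + weight es b l R A'"
    using Cons.IH[OF fold, of "U + A c u"] by blast
  \<comment> \<open>Later steps add only vertices of \<open>us\<close>, so the membership of
    \<open>u\<close> is settled here.\<close>
  have c: "u \<in> set S' \<longleftrightarrow> c"
    using sub Cons.prems(2,4) by (auto split: if_splits)
  have "(if b then E else U) + weight es b l (set (u # us) \<union> R) A =
      (if b then E' else U') + weight es b l R A'"
    if "\<forall>u\<in>set (u # us). l u = (u \<in> set S')" for b l
  proof -
    have "weight es b l (set (u # us) \<union> R) A = A (c \<noteq> b) u + weight es b l (set us \<union> R) ?A"
      using weight_insert[of "set us \<union> R" u es l c b A] that c Cons.prems(2,3) assms(5,6) by auto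
    with eq[of l b] that show ?thesis by (cases b) auto
  qed
  with sub U' show ?case by (auto split: if_splits)
qed


section \<open>The colouring of a hierarchical specification\<close>

text \<open>The last cell is treated as a cell without pins, since nothing else determines their colours.\<close>

definition open_pins :: "spec \<Rightarrow> nat \<Rightarrow> nat list" where
  "open_pins \<Gamma> i = (if Suc i = length \<Gamma> then [] else pins (\<Gamma> ! i))"

definition inner :: "spec \<Rightarrow> nat \<Rightarrow> nat list" where
  "inner \<Gamma> i =
     filter (\<lambda>v. v \<notin> nonterminals (\<Gamma> ! i) \<and> v \<notin> set (open_pins \<Gamma> i)) (verts (\<Gamma> ! i))"

text \<open>\<open>rev\<close> anticipates the program, which builds adjacency lists by prepending;
  thus the lists agree entry by entry. Edges at nonterminals are kept: they alter only counts at
  nonterminals, which never decide a colour. The tests \<open>j < i\<close> serve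
  termination.\<close>

fun colour :: "spec \<Rightarrow> nat \<Rightarrow> nat list \<times> (bool \<Rightarrow> nat \<Rightarrow> nat) \<times> nat" where
  "colour \<Gamma> i =
     fold (greedy_step (adj (rev (edges (\<Gamma> ! i))))) (inner \<Gamma> i)
       ([],
        \<lambda>b v. \<Sum>(x, j, ns)\<leftarrow>nonts (\<Gamma> ! i). \<Sum>k<length ns.
          if j < i then if ns ! k = v then fst (snd (colour \<Gamma> j)) b (pins (\<Gamma> ! j) ! k) else 0 else 0,
        \<Sum>(x, j, ns)\<leftarrow>nonts (\<Gamma> ! i). if j < i then snd (snd (colour \<Gamma> j)) else 0)"

declare colour.simps [simp del]

definition chosen :: "spec \<Rightarrow> nat \<Rightarrow> nat list" where
  "chosen \<Gamma> i = fst (colour \<Gamma> i)"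

definition degrees :: "spec \<Rightarrow> nat \<Rightarrow> bool \<Rightarrow> nat \<Rightarrow> nat" where
  "degrees \<Gamma> i = fst (snd (colour \<Gamma> i))"

definition cut_size :: "spec \<Rightarrow> nat \<Rightarrow> nat" where
  "cut_size \<Gamma> i = snd (snd (colour \<Gamma> i))"

definition degrees_below :: "spec \<Rightarrow> nat \<Rightarrow> bool \<Rightarrow> nat \<Rightarrow> nat" where
  "degrees_below \<Gamma> i b v = (\<Sum>(x, j, ns)\<leftarrow>nonts (\<Gamma> ! i). \<Sum>k<length ns.
     if ns ! k = v then degrees \<Gamma> j b (pins (\<Gamma> ! j) ! k) else 0)"

text \<open>Extending the path replaces \<open>graft\<close>, because \<open>chosen\<close> contains
  only vertices of \<open>inner\<close>: the pins of a cell used as a type are coloured in the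
  enclosing cell.\<close>

fun chosen_upto :: "spec \<Rightarrow> nat \<Rightarrow> xvertex set" where
  "chosen_upto \<Gamma> i =
     Pair [] ` set (chosen \<Gamma> i) \<union>
     (\<Union>(x, j, ns)\<in>set (nonts (\<Gamma> ! i)).
        if j < i then (\<lambda>(\<pi>, v). (x # \<pi>, v)) ` chosen_upto \<Gamma> j else {})"

text \<open>Tells whether any vertex of the expansion is chosen. A nonterminal whose type fails this
  must be dropped, since otherwise the dummy vertex that keeps the cell nonempty would appear in the
  expansion.\<close>

fun alive :: "spec \<Rightarrow> nat \<Rightarrow> bool" where
  "alive \<Gamma> i \<longleftrightarrow>
     chosen \<Gamma> i \<noteq> [] \<or> (\<exists>(x, j, ns)\<in>set (nonts (\<Gamma> ! i)). if j < i then alive \<Gamma> j else False)"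

declare chosen_upto.simps [simp del] alive.simps [simp del]

text \<open>The colouring of an expansion whose open pins are still undecided: these take the
  parameter \<open>l\<close>, everything else is fixed.\<close>

definition labelling :: "spec \<Rightarrow> nat \<Rightarrow> (nat \<Rightarrow> bool) \<Rightarrow> xvertex \<Rightarrow> bool" where
  "labelling \<Gamma> i l y \<longleftrightarrow>
     (if fst y = [] \<and> snd y \<in> set (open_pins \<Gamma> i) then l (snd y) else y \<in> chosen_upto \<Gamma> i)"

text \<open>Being a predicate on arbitrary sets, it commutes with images without any injectivity;
  this transfers the edges of a copy along \<open>graft\<close>.\<close>

definition bichromatic :: "('a \<Rightarrow> bool) \<Rightarrow> 'a set \<Rightarrow> bool" where
  "bichromatic l e \<longleftrightarrow> (\<exists>u\<in>e. \<exists>v\<in>e. l u \<noteq> l v)"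

section \<open>Edges of the expansion and the trivial bound on the optimum\<close>

lemma bichromatic_image: "bichromatic l (f ` e) = bichromatic (l \<circ> f) e"
  by (auto simp: bichromatic_def)

lemma bichromatic_edge: "bichromatic l {u, v} \<longleftrightarrow> l u \<noteq> l v"
  by (auto simp: bichromatic_def)

lemma in_sum_list_mset: "e \<in># (\<Sum>x\<leftarrow>xs. f x) \<longleftrightarrow> (\<exists>x\<in>set xs. e \<in># f x)"
  by (induction xs) auto

text \<open>Serves to pass from \<open>bichromatic\<close> to \<open>crossing\<close>, which asks
  for endpoints in the two given vertex sets.\<close>

lemma edges_upto_verts:
  "e \<in># edges_upto \<Gamma> i \<Longrightarrow> \<exists>u\<in>verts_upto \<Gamma> i. \<exists>v\<in>verts_upto \<Gamma> i. e = {u, v}"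
proof (induction \<Gamma> i arbitrary: e rule: edges_upto.induct)
  case (1 \<Gamma> i)
  from 1(2) consider
    (here) u v where "u \<in> terminals (\<Gamma> ! i)" "v \<in> terminals (\<Gamma> ! i)" "e = {([], u), ([], v)}"
  | (below) x j ns e' where "(x, j, ns) \<in> set (nonts (\<Gamma> ! i))" "j < i" "e' \<in># edges_upto \<Gamma> j"
      "e = graft x (pins (\<Gamma> ! j)) ns ` e'"
    by (subst (asm) edges_upto.simps) (auto simp: in_sum_list_mset split: if_splits)
  then show ?case
  proof cases
    case here
    then show ?thesis by (subst (1 2) verts_upto.simps) auto
  next
    case below
    with 1(1)[OF below(1) refl refl below(2,3)] obtain u v
      where uv: "u \<in> verts_upto \<Gamma> j" "v \<in> verts_upto \<Gamma> j" "e' = {u, v}" by auto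
    let ?g = "graft x (pins (\<Gamma> ! j)) ns"
    have "?g ` verts_upto \<Gamma> j \<subseteq> verts_upto \<Gamma> i"
      by (subst (2) verts_upto.simps) (use below(1,2) in force)
    then have "?g u \<in> verts_upto \<Gamma> i" "?g v \<in> verts_upto \<Gamma> i" using uv by auto
    moreover have "e = {?g u, ?g v}" using below(4) uv(3) by simp
    ultimately show ?thesis by blast
  qed
qed

lemma size_filter_sum_list:
  "size (filter_mset P (\<Sum>x\<leftarrow>xs. f x)) = (\<Sum>x\<leftarrow>xs. size (filter_mset P (f x)))"
  by (induction xs) auto

text \<open>The guarantee compares with all edges rather than with an optimal cut. The cut values
  form a finite set because they are bounded, so \<open>Max\<close> is meaningful for any
  \<open>V\<close>.\<close>

lemma max_cut_le_size: "max_cut V Es \<le> size Es"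
proof -
  have *: "crossing Es S (V - S) \<le> size Es" for S
    unfolding crossing_def by (rule size_filter_mset_lesseq)
  have "{crossing Es S (V - S) | S. S \<subseteq> V} \<subseteq> {..size Es}"
    using * by auto
  then have "finite {crossing Es S (V - S) | S. S \<subseteq> V}"
    by (rule finite_subset) simp
  then show ?thesis unfolding max_cut_def by (rule Max.boundedI) (use * in auto)
qed

section \<open>Correctness of the colouring\<close>

locale simple_hierarchy =
  fixes \<Gamma> :: spec
  assumes hier: "hier_spec \<Gamma>" and simple: "simple_spec \<Gamma>"
begin

lemma cellD:
  assumes "i < length \<Gamma>"
  shows "verts (\<Gamma> ! i) \<noteq> []" "distinct (verts (\<Gamma> ! i))"
    "\<And>u v. (u, v) \<in> set (edges (\<Gamma> ! i)) \<Longrightarrow> u \<in> set (verts (\<Gamma> ! i))"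
    "\<And>u v. (u, v) \<in> set (edges (\<Gamma> ! i)) \<Longrightarrow> v \<in> set (verts (\<Gamma> ! i))"
    "\<And>u v. (u, v) \<in> set (edges (\<Gamma> ! i)) \<Longrightarrow> u \<noteq> v"
    "distinct (map (\<lambda>(u, v). {u, v}) (edges (\<Gamma> ! i)))"
    "distinct (pins (\<Gamma> ! i))" "set (pins (\<Gamma> ! i)) \<subseteq> set (verts (\<Gamma> ! i))"
    "distinct (map fst (nonts (\<Gamma> ! i)))"
    "nonterminals (\<Gamma> ! i) \<subseteq> set (verts (\<Gamma> ! i)) - set (pins (\<Gamma> ! i))"
  using hier assms unfolding hier_spec_def simple_graph_def Let_def by blast+

lemma nontD:
  assumes "i < length \<Gamma>" "(x, j, ns) \<in> set (nonts (\<Gamma> ! i))"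
  shows "j < i" "distinct ns" "length ns = length (pins (\<Gamma> ! j))"
    "set ns = neighbours (\<Gamma> ! i) x" "set ns \<subseteq> terminals (\<Gamma> ! i)"
  using hier assms unfolding hier_spec_def Let_def by fast+

lemma open_pins_below: "j < i \<Longrightarrow> i < length \<Gamma> \<Longrightarrow> open_pins \<Gamma> j = pins (\<Gamma> ! j)"
  by (simp add: open_pins_def)

lemma open_pins_subset: "set (open_pins \<Gamma> i) \<subseteq> set (pins (\<Gamma> ! i))"
  by (simp add: open_pins_def)

lemma colour_eq:
  assumes "i < length \<Gamma>"
  shows "fold (greedy_step (adj (rev (edges (\<Gamma> ! i))))) (inner \<Gamma> i)
      ([], degrees_below \<Gamma> i, \<Sum>(x, j, ns)\<leftarrow>nonts (\<Gamma> ! i). cut_size \<Gamma> j) =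
    (chosen \<Gamma> i, degrees \<Gamma> i, cut_size \<Gamma> i)"
proof -
  have "(\<lambda>b v. \<Sum>(x, j, ns)\<leftarrow>nonts (\<Gamma> ! i). \<Sum>k<length ns. if j < i then
      if ns ! k = v then fst (snd (colour \<Gamma> j)) b (pins (\<Gamma> ! j) ! k) else 0 else 0) =
    degrees_below \<Gamma> i"
    unfolding degrees_below_def degrees_def
    by (intro ext arg_cong[where f = sum_list] map_cong refl) (auto dest: nontD(1)[OF assms])
  moreover have "(\<Sum>(x, j, ns)\<leftarrow>nonts (\<Gamma> ! i). if j < i then snd (snd (colour \<Gamma> j)) else 0) =
      (\<Sum>(x, j, ns)\<leftarrow>nonts (\<Gamma> ! i). cut_size \<Gamma> j)"
    unfolding cut_size_def
    by (intro arg_cong[where f = sum_list] map_cong refl) (auto dest: nontD(1)[OF assms])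
  ultimately have "colour \<Gamma> i = fold (greedy_step (adj (rev (edges (\<Gamma> ! i))))) (inner \<Gamma> i)
      ([], degrees_below \<Gamma> i, \<Sum>(x, j, ns)\<leftarrow>nonts (\<Gamma> ! i). cut_size \<Gamma> j)"
    by (subst colour.simps) simp
  then show ?thesis by (simp add: chosen_def degrees_def cut_size_def)
qed

lemma alive_iff:
  assumes "i < length \<Gamma>"
  shows "alive \<Gamma> i \<longleftrightarrow> chosen \<Gamma> i \<noteq> [] \<or> (\<exists>(x, j, ns)\<in>set (nonts (\<Gamma> ! i)). alive \<Gamma> j)"
  using nontD(1)[OF assms] by (subst alive.simps) fastforce

lemma distinct_inner: "i < length \<Gamma> \<Longrightarrow> distinct (inner \<Gamma> i)"
  by (simp add: inner_def cellD)

lemma terminals_eq: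
  "i < length \<Gamma> \<Longrightarrow> terminals (\<Gamma> ! i) = set (inner \<Gamma> i) \<union> set (open_pins \<Gamma> i)"
  using cellD(8,10)[of i] open_pins_subset[of i] by (auto simp: terminals_def inner_def)

lemma inner_open_pins: "set (inner \<Gamma> i) \<inter> set (open_pins \<Gamma> i) = {}"
  by (auto simp: inner_def)

lemma chosen_subset:
  assumes "i < length \<Gamma>"
  shows "set (chosen \<Gamma> i) \<subseteq> set (inner \<Gamma> i)"
  \<comment> \<open>Only the inclusion is wanted; \<open>R = {}\<close> and \<open>U = 0\<close> are
    merely admissible values.\<close>
  using greedy_weight[OF colour_eq[OF assms] distinct_inner[OF assms], of "{}" 0]
    cellD(5)[OF assms] by auto

lemma distinct_chosen:
  assumes "i < length \<Gamma>"
  shows "distinct (chosen \<Gamma> i)"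
proof -
  have "distinct (fst (fold (greedy_step nb) us st))"
    if "distinct us" "set us \<inter> set (fst st) = {}" "distinct (fst st)" for nb us st
    using that by (induction us arbitrary: st) (auto simp: Let_def split: if_splits)
  from this[OF distinct_inner[OF assms]] colour_eq[OF assms] show ?thesis
    by (metis distinct.simps(1) empty_set fst_conv inf_bot_right)
qed

lemma chosen_upto_Nil: "([], v) \<in> chosen_upto \<Gamma> i \<longleftrightarrow> v \<in> set (chosen \<Gamma> i)"
  by (subst chosen_upto.simps) (auto split: if_splits)

text \<open>Nonterminals are listed once each, so the head \<open>x\<close> of a path determines the
  type of the copy.\<close>

lemma chosen_upto_Cons:
  assumes "i < length \<Gamma>" "(x, j, ns) \<in> set (nonts (\<Gamma> ! i))"
  shows "(x # \<pi>, v) \<in> chosen_upto \<Gamma> i \<longleftrightarrow> (\<pi>, v) \<in> chosen_upto \<Gamma> j"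
proof -
  have "j' = j" if "(x, j', ns') \<in> set (nonts (\<Gamma> ! i))" for j' ns'
    using cellD(9)[OF assms(1)] assms(2) that by (metis eq_key_imp_eq_value fst_conv)
  moreover have "\<exists>j' ns'. (x, j', ns') \<in> set (nonts (\<Gamma> ! i)) \<and> (\<pi>, v) \<in> chosen_upto \<Gamma> j'"
    if "(x # \<pi>, v) \<in> chosen_upto \<Gamma> i"
    using that unfolding chosen_upto.simps[of \<Gamma> i] by (auto split: if_splits) blast+
  moreover have "(x # \<pi>, v) \<in> chosen_upto \<Gamma> i" if "(\<pi>, v) \<in> chosen_upto \<Gamma> j"
    unfolding chosen_upto.simps[of \<Gamma> i] using that nontD(1)[OF assms]
    by (intro UnI2 UN_I[OF assms(2)]) (auto intro: image_eqI[of _ _ "(\<pi>, v)"])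
  ultimately show ?thesis by blast
qed

text \<open>A copy sees its surroundings only through its pins, and each pin takes the colour of the
  neighbour it is identified with. This makes a statement about a type, quantified over pin
  colourings, applicable to every copy.\<close>

lemma labelling_graft:
  assumes "i < length \<Gamma>" "(x, j, ns) \<in> set (nonts (\<Gamma> ! i))"
  shows "labelling \<Gamma> i l (graft x (pins (\<Gamma> ! j)) ns y) =
    labelling \<Gamma> j (\<lambda>p. labelling \<Gamma> i l ([], the (map_of (zip (pins (\<Gamma> ! j)) ns) p))) y"
  using chosen_upto_Cons[OF assms] open_pins_below[OF nontD(1)[OF assms] assms(1)]
  by (cases y) (auto simp: labelling_def)

lemma no_pin_edges: "i < length \<Gamma> \<Longrightarrow> (u, v) \<in> set (edges (\<Gamma> ! i)) \<Longrightarrow>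
    u \<notin> set (pins (\<Gamma> ! i)) \<or> v \<notin> set (pins (\<Gamma> ! i))"
  using simple nth_mem[of i \<Gamma>] unfolding simple_spec_def by blast

text \<open>Double counting: \<open>ns ! k\<close> is a single terminal and corresponds to pin
  \<open>k\<close> of the type, so a sum over the terminals of the cell becomes a sum over the pins
  of all copies. The function \<open>f\<close> will select the colour
  \<open>l v \<noteq> b\<close>.\<close>

lemma sum_degrees_below:
  assumes "i < length \<Gamma>"
  shows "(\<Sum>v\<in>terminals (\<Gamma> ! i). degrees_below \<Gamma> i (f v) v) =
    (\<Sum>(x, j, ns)\<leftarrow>nonts (\<Gamma> ! i). \<Sum>p\<in>set (pins (\<Gamma> ! j)).
      degrees \<Gamma> j (f (the (map_of (zip (pins (\<Gamma> ! j)) ns) p))) p)"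
proof -
  have fin: "finite (terminals (\<Gamma> ! i))" by (simp add: terminals_def)
  have "(\<Sum>v\<in>terminals (\<Gamma> ! i). degrees_below \<Gamma> i (f v) v) =
    (\<Sum>t\<leftarrow>nonts (\<Gamma> ! i). \<Sum>v\<in>terminals (\<Gamma> ! i). case t of (x, j, ns) \<Rightarrow> \<Sum>k<length ns.
     if ns ! k = v then degrees \<Gamma> j (f v) (pins (\<Gamma> ! j) ! k) else 0)"
    unfolding degrees_below_def by (induction "nonts (\<Gamma> ! i)") (auto simp: sum.distrib sum_list_sum_nth sum.swap[of _ _ "terminals (\<Gamma> ! i)"])
  also have "\<dots> = (\<Sum>(x, j, ns)\<leftarrow>nonts (\<Gamma> ! i). \<Sum>p\<in>set (pins (\<Gamma> ! j)).
      degrees \<Gamma> j (f (the (map_of (zip (pins (\<Gamma> ! j)) ns) p))) p)"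
  proof (intro arg_cong[where f = sum_list] map_cong refl, clarify)
    fix x j ns assume t: "(x, j, ns) \<in> set (nonts (\<Gamma> ! i))"
    note n = nontD[OF assms t]
    let ?ps = "pins (\<Gamma> ! j)"
    have d: "distinct ?ps" using cellD(7)[of j] n(1) assms by simp
    have "(\<Sum>v\<in>terminals (\<Gamma> ! i). \<Sum>k<length ns. if ns ! k = v then degrees \<Gamma> j (f v) (?ps ! k) else 0) =
      (\<Sum>k<length ns. \<Sum>v\<in>terminals (\<Gamma> ! i). if ns ! k = v then degrees \<Gamma> j (f v) (?ps ! k) else 0)"
      by (rule sum.swap)
    also have "\<dots> = (\<Sum>k<length ns. degrees \<Gamma> j (f (ns ! k)) (?ps ! k))"
    proof (rule sum.cong[OF refl])
      fix k assume "k \<in> {..<length ns}"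
      then have "ns ! k \<in> terminals (\<Gamma> ! i)" using n(5) by auto
      then show "(\<Sum>v\<in>terminals (\<Gamma> ! i). if ns ! k = v then degrees \<Gamma> j (f v) (?ps ! k) else 0) =
        degrees \<Gamma> j (f (ns ! k)) (?ps ! k)"
        using fin by (simp add: sum.delta)
    qed
    also have "\<dots> = (\<Sum>k<length ?ps. degrees \<Gamma> j (f (the (map_of (zip ?ps ns) (?ps ! k)))) (?ps ! k))"
      using n(3) d by (intro sum.cong) (auto simp: map_of_zip_nth)
    also have "\<dots> = (\<Sum>p\<in>set ?ps. degrees \<Gamma> j (f (the (map_of (zip ?ps ns) p))) p)"
      using sum.reindex_bij_betw[OF bij_betw_nth[OF d refl refl],
        of "\<lambda>p. degrees \<Gamma> j (f (the (map_of (zip ?ps ns) p))) p"] by simp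
    finally show "(\<Sum>v\<in>terminals (\<Gamma> ! i). \<Sum>k<length ns. if ns ! k = v then degrees \<Gamma> j (f v) (?ps ! k) else 0) =
      (\<Sum>p\<in>set ?ps. degrees \<Gamma> j (f (the (map_of (zip ?ps ns) p))) p)" .
  qed
  finally show ?thesis .
qed

text \<open>
  Since pins are pairwise nonadjacent, the number of cut edges of an expansion depends on the
  colours of the pins only through a sum with one summand per pin.  This is what allows all copies
  of a cell to be coloured in the same way, before the colours of their pins are known.
\<close>

lemma count_edges_upto:
  assumes "i < length \<Gamma>"
  shows "\<exists>U\<le>cut_size \<Gamma> i. \<forall>l b.
    size {#e \<in># edges_upto \<Gamma> i. bichromatic (labelling \<Gamma> i l) e = b#} =
    (if b then cut_size \<Gamma> i else U) + (\<Sum>p\<in>set (open_pins \<Gamma> i). degrees \<Gamma> i (l p \<noteq> b) p)"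
  using assms
proof (induction i rule: less_induct)
  case (less i)
  let ?C = "\<Gamma> ! i" and ?T = "terminals (\<Gamma> ! i)" and ?es = "rev (edges (\<Gamma> ! i))"
  let ?Q = "\<lambda>j U. U \<le> cut_size \<Gamma> j \<and> (\<forall>l b.
    size {#e \<in># edges_upto \<Gamma> j. bichromatic (labelling \<Gamma> j l) e = b#} =
    (if b then cut_size \<Gamma> j else U) + (\<Sum>p\<in>set (pins (\<Gamma> ! j)). degrees \<Gamma> j (l p \<noteq> b) p))"
  have "\<exists>U. ?Q j U" if "j < i" for j
    using less.IH[OF that] that less.prems unfolding open_pins_below[OF that less.prems] by simp
  \<comment> \<open>The values are fixed for all types at once, so that \<open>U j\<close> depends
    neither on the pin colouring nor on \<open>b\<close>.\<close>
  then have "\<forall>j. \<exists>U. j < i \<longrightarrow> ?Q j U" by blast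
  from choice[OF this] obtain U where Q: "\<And>j. j < i \<Longrightarrow> ?Q j (U j)" by blast
  then have U: "\<And>j. j < i \<Longrightarrow> U j \<le> cut_size \<Gamma> j" by blast
  have IH: "size {#e \<in># edges_upto \<Gamma> j. bichromatic (labelling \<Gamma> j l) e = b#} =
      (if b then cut_size \<Gamma> j else U j) + (\<Sum>p\<in>set (pins (\<Gamma> ! j)). degrees \<Gamma> j (l p \<noteq> b) p)"
    if "j < i" for j l b
    using Q[OF that] by blast
  let ?U = "\<Sum>(x, j, ns)\<leftarrow>nonts ?C. U j" and ?E = "\<Sum>(x, j, ns)\<leftarrow>nonts ?C. cut_size \<Gamma> j"
  have "?U \<le> ?E"
    by (rule sum_list_mono) (auto dest: nontD(1)[OF less.prems] intro: U)
  then obtain U' where U': "U' \<le> cut_size \<Gamma> i" and greedy: "\<And>b l.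
      \<forall>u\<in>set (inner \<Gamma> i). l u = (u \<in> set (chosen \<Gamma> i)) \<Longrightarrow>
      (if b then ?E else ?U) + weight ?es b l ?T (degrees_below \<Gamma> i) =
      (if b then cut_size \<Gamma> i else U') + weight ?es b l (set (open_pins \<Gamma> i)) (degrees \<Gamma> i)"
    using greedy_weight[OF colour_eq[OF less.prems] distinct_inner[OF less.prems] inner_open_pins,
        of ?U] cellD(5)[OF less.prems] by (auto simp: terminals_eq[OF less.prems])
  have "size {#e \<in># edges_upto \<Gamma> i. bichromatic (labelling \<Gamma> i l) e = b#} =
      (if b then cut_size \<Gamma> i else U') + (\<Sum>p\<in>set (open_pins \<Gamma> i). degrees \<Gamma> i (l p \<noteq> b) p)" for l b
  proof -
    let ?L = "labelling \<Gamma> i l" and ?l = "\<lambda>v. labelling \<Gamma> i l ([], v)"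
    let ?P = "\<lambda>e. bichromatic ?L e = b"
    have below: "size {#e \<in># if j < i then image_mset (image (graft x (pins (\<Gamma> ! j)) ns)) (edges_upto \<Gamma> j) else {#}. ?P e#} =
      (if b then cut_size \<Gamma> j else U j) + (\<Sum>p\<in>set (pins (\<Gamma> ! j)).
        degrees \<Gamma> j (?l (the (map_of (zip (pins (\<Gamma> ! j)) ns) p)) \<noteq> b) p)"
      if "(x, j, ns) \<in> set (nonts ?C)" for x j ns
    proof -
      have "?L \<circ> graft x (pins (\<Gamma> ! j)) ns =
        labelling \<Gamma> j (\<lambda>p. ?l (the (map_of (zip (pins (\<Gamma> ! j)) ns) p)))"
        using labelling_graft[OF less.prems that] by (simp add: fun_eq_iff)
      then show ?thesis
        using IH nontD(1)[OF less.prems that]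
        by (simp add: filter_mset_image_mset bichromatic_image)
    qed
    have "size {#e \<in># edges_upto \<Gamma> i. ?P e#} =
      length (filter (\<lambda>(u, v). u \<in> ?T \<and> v \<in> ?T \<and> (?l u \<noteq> ?l v) = b) (edges ?C)) +
      (\<Sum>(x, j, ns)\<leftarrow>nonts ?C. size {#e \<in># if j < i then image_mset (image (graft x (pins (\<Gamma> ! j)) ns)) (edges_upto \<Gamma> j) else {#}. ?P e#})"
      (is "_ = ?here + _")
    proof -
      have *: "size {#e \<in># mset (map (\<lambda>(u, v). {([], u), ([], v)}) (filter (\<lambda>(u, v). u \<in> ?T \<and> v \<in> ?T) es)). ?P e#} =
        length (filter (\<lambda>(u, v). u \<in> ?T \<and> v \<in> ?T \<and> (?l u \<noteq> ?l v) = b) es)" for es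
        by (induction es) (auto simp: bichromatic_edge)
      show ?thesis
        by (subst edges_upto.simps)
          (simp add: *[unfolded case_prod_unfold] size_filter_sum_list case_prod_unfold del: mset_map mset_filter)
    qed
    also have "\<dots> = ?here + (\<Sum>(x, j, ns)\<leftarrow>nonts ?C. (if b then cut_size \<Gamma> j else U j) +
        (\<Sum>p\<in>set (pins (\<Gamma> ! j)). degrees \<Gamma> j (?l (the (map_of (zip (pins (\<Gamma> ! j)) ns) p)) \<noteq> b) p))"
      by (intro arg_cong2[where f = plus] arg_cong[where f = sum_list] map_cong refl)
        (use below in \<open>auto simp del: filter_mset_image_mset\<close>)
    also have "\<dots> = ?here + (if b then ?E else ?U) + (\<Sum>(x, j, ns)\<leftarrow>nonts ?C.
        \<Sum>p\<in>set (pins (\<Gamma> ! j)). degrees \<Gamma> j (?l (the (map_of (zip (pins (\<Gamma> ! j)) ns) p)) \<noteq> b) p)"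
      by (simp add: sum_list_addf case_prod_unfold)
    \<comment> \<open>Nothing in this cell is coloured yet: what the copies leave open at their pins
      becomes the counts \<open>degrees_below\<close> at the terminals.\<close>
    also have "\<dots> = (if b then ?E else ?U) + weight ?es b ?l ?T (degrees_below \<Gamma> i)"
      using sum_degrees_below[OF less.prems, of "\<lambda>v. ?l v \<noteq> b"]
      by (simp add: weight_def rev_filter[symmetric])
    also have "\<dots> = (if b then cut_size \<Gamma> i else U') + weight ?es b ?l (set (open_pins \<Gamma> i)) (degrees \<Gamma> i)"
      by (rule greedy) (auto simp: labelling_def chosen_upto_Nil inner_def)
    also have "weight ?es b ?l (set (open_pins \<Gamma> i)) (degrees \<Gamma> i) =
        (\<Sum>p\<in>set (open_pins \<Gamma> i). degrees \<Gamma> i (l p \<noteq> b) p)"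
    proof -
      \<comment> \<open>Simplicity enters here: an edge between two pins would contribute a term
        that depends on both colours.\<close>
      have "filter (\<lambda>(x, y). x \<in> set (open_pins \<Gamma> i) \<and> y \<in> set (open_pins \<Gamma> i) \<and>
          (?l x \<noteq> ?l y) = b) ?es = []"
        using no_pin_edges[OF less.prems] open_pins_subset[of i]
        by (auto simp: filter_empty_conv)
      then have "weight ?es b ?l (set (open_pins \<Gamma> i)) (degrees \<Gamma> i) =
          (\<Sum>p\<in>set (open_pins \<Gamma> i). degrees \<Gamma> i (?l p \<noteq> b) p)"
        unfolding weight_def by (simp only: list.size add_0_right)
      then show ?thesis by (simp add: labelling_def cong: sum.cong)
    qed
    finally show ?thesis .
  qed
  with U' show ?case by blast
qed

text \<open>By induction no type supplies any counts, so a first inner vertex would see 0 against 0,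
  and the tie would put it into \<open>V\<^sub>1\<close>. Hence there is no inner vertex, and the
  counts stay 0.\<close>

lemma dead:
  assumes "i < length \<Gamma>" "\<not> alive \<Gamma> i"
  shows "inner \<Gamma> i = [] \<and> degrees \<Gamma> i = (\<lambda>_ _. 0)"
  using assms
proof (induction i rule: less_induct)
  case (less i)
  have ch: "chosen \<Gamma> i = []" using less.prems(2) by (simp add: alive_iff less.prems(1))
  have "degrees \<Gamma> j = (\<lambda>_ _. 0)" if "(x, j, ns) \<in> set (nonts (\<Gamma> ! i))" for x j ns
  proof -
    have "j < i" using nontD(1)[OF less.prems(1) that] .
    moreover have "\<not> alive \<Gamma> j"
      using less.prems that by (auto simp: alive_iff)
    ultimately show ?thesis using less.IH less.prems(1) by auto
  qed
  then have zero: "degrees_below \<Gamma> i = (\<lambda>_ _. 0)"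
    unfolding degrees_below_def by (fastforce simp: fun_eq_iff sum_list_eq_0_iff)
  note eq = colour_eq[OF less.prems(1)]
  have "inner \<Gamma> i = []"
  proof (cases "inner \<Gamma> i")
    case (Cons u us)
    have "set us \<inter> set [u] = {}" "distinct us"
      using distinct_inner[OF less.prems(1)] Cons by auto
    then have "u \<in> set (chosen \<Gamma> i)"
      using greedy_weight[of "rev (edges (\<Gamma> ! i))" us "[u]" _ _ "chosen \<Gamma> i" _ _ "{}" 0]
        eq cellD(5)[OF less.prems(1)] by (fastforce simp: Cons zero)
    with ch show ?thesis by simp
  qed
  with eq zero show ?case by simp
qed

text \<open>Descent: a dead cell without open pins has no terminals, but it has a vertex. This is a
  nonterminal without neighbours, so its type is dead and without pins as well, and has a smaller
  index. In particular the dummy never stands for the outermost cell.\<close>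

lemma alive_if_no_open_pins: "i < length \<Gamma> \<Longrightarrow> open_pins \<Gamma> i = [] \<Longrightarrow> alive \<Gamma> i"
proof (induction i rule: less_induct)
  case (less i)
  show ?case
  proof (rule ccontr)
    assume d: "\<not> alive \<Gamma> i"
    then have T: "terminals (\<Gamma> ! i) = {}"
      using terminals_eq[OF less.prems(1)] dead[OF less.prems(1)] less.prems(2) by simp
    then obtain x j ns where t: "(x, j, ns) \<in> set (nonts (\<Gamma> ! i))"
      using hd_in_set[OF cellD(1)[OF less.prems(1)]] by (fastforce simp: terminals_def nonterminals_def)
    note n = nontD[OF less.prems(1) t]
    have "pins (\<Gamma> ! j) = []" using n(3,5) T by auto
    then have "alive \<Gamma> j"
      using less.IH[OF n(1)] less.prems(1) n(1) open_pins_below[OF n(1)] by simp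
    with d t less.prems(1) show False by (auto simp: alive_iff)
  qed
qed

lemma chosen_upto_dead: "i < length \<Gamma> \<Longrightarrow> \<not> alive \<Gamma> i \<Longrightarrow> chosen_upto \<Gamma> i = {}"
proof (induction i rule: less_induct)
  case (less i)
  have "chosen_upto \<Gamma> j = {}" if "(x, j, ns) \<in> set (nonts (\<Gamma> ! i))" "j < i" for x j ns
    using that less.IH[of j] less.prems by (auto simp: alive_iff)
  moreover have "chosen \<Gamma> i = []" using less.prems by (simp add: alive_iff)
  ultimately show ?case by (subst chosen_upto.simps) (auto split: if_splits)
qed

lemma chosen_upto_subset: "i < length \<Gamma> \<Longrightarrow> chosen_upto \<Gamma> i \<subseteq> verts_upto \<Gamma> i"
proof (induction i rule: less_induct)
  case (less i)
  show ?case
  proof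
    fix y assume "y \<in> chosen_upto \<Gamma> i"
    then consider (here) v where "y = ([], v)" "v \<in> set (chosen \<Gamma> i)"
      | (below) x j ns \<pi> v where "(x, j, ns) \<in> set (nonts (\<Gamma> ! i))" "j < i"
        "(\<pi>, v) \<in> chosen_upto \<Gamma> j" "y = (x # \<pi>, v)"
      by (subst (asm) chosen_upto.simps) (auto split: if_splits)
    then show "y \<in> verts_upto \<Gamma> i"
    proof cases
      case here
      then have "v \<in> terminals (\<Gamma> ! i)"
        using chosen_subset[OF less.prems] terminals_eq[OF less.prems] by auto
      with here show ?thesis by (subst verts_upto.simps) auto
    next
      case below
      then have "(\<pi>, v) \<in> verts_upto \<Gamma> j" using less by auto
      \<comment> \<open>A chosen vertex of the copy is no pin, so \<open>graft\<close> merely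
        extends its path.\<close>
      moreover have "\<not> (\<pi> = [] \<and> v \<in> set (pins (\<Gamma> ! j)))"
        using below(2,3) less.prems chosen_subset[of j] inner_open_pins[of j] open_pins_below[of j i]
        by (auto simp: chosen_upto_Nil)
      then have "y = graft x (pins (\<Gamma> ! j)) ns (\<pi>, v)" using below(4) by auto
      ultimately have "y \<in> (case (x, j, ns) of (x, j, ns) \<Rightarrow>
          if j < i then graft x (pins (\<Gamma> ! j)) ns ` verts_upto \<Gamma> j else {})"
        using below(2) by (simp del: graft.simps)
      then show ?thesis using below(1) unfolding verts_upto.simps[of \<Gamma> i] by blast
    qed
  qed
qed

section \<open>The specification of the chosen vertices\<close>

definition alive_nonts :: "nat \<Rightarrow> (nat \<times> nat \<times> nat list) list" where
  "alive_nonts i = filter (\<lambda>(x, j, ns). alive \<Gamma> j) (nonts (\<Gamma> ! i))"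

text \<open>Cells without chosen vertices are replaced by a dummy cell to which no cell refers.\<close>

definition chosen_cell :: "nat \<Rightarrow> cell" where
  "chosen_cell i =
     \<lparr>verts = (if alive \<Gamma> i then chosen \<Gamma> i @ map fst (alive_nonts i) else [0]), edges = [],
      pins = [], nonts = map (\<lambda>(x, j, ns). (x, j, [])) (alive_nonts i)\<rparr>"

definition chosen_spec :: spec where
  "chosen_spec = map chosen_cell [0..<length \<Gamma>]"

text \<open>This form of \<open>alive\<close> can be tested by the program, which has both lists at
  hand when it writes the cell.\<close>

lemma alive_iff_alive_nonts: "i < length \<Gamma> \<Longrightarrow> alive \<Gamma> i \<longleftrightarrow> chosen \<Gamma> i \<noteq> [] \<or> alive_nonts i \<noteq> []"
  by (auto simp: alive_iff alive_nonts_def filter_empty_conv)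

lemma nonterminals_chosen_cell: "nonterminals (chosen_cell i) = fst ` set (alive_nonts i)"
  by (simp add: chosen_cell_def nonterminals_def image_image case_prod_unfold)

lemma hier_chosen_spec: "hier_spec chosen_spec"
  unfolding hier_spec_def Let_def
proof (intro conjI allI impI)
  show "chosen_spec \<noteq> []" using hier by (simp add: chosen_spec_def hier_spec_def)
next
  fix i assume "i < length chosen_spec"
  then have i: "i < length \<Gamma>" and C: "chosen_spec ! i = chosen_cell i"
    by (simp_all add: chosen_spec_def)
  have "set (map fst (alive_nonts i)) \<subseteq> nonterminals (\<Gamma> ! i)"
    by (auto simp: alive_nonts_def nonterminals_def image_iff)
  moreover have d: "distinct (map fst (alive_nonts i))"
    unfolding alive_nonts_def by (rule distinct_map_filter[OF cellD(9)[OF i]])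
  ultimately show "simple_graph (chosen_spec ! i)"
    using distinct_chosen[OF i] chosen_subset[OF i] alive_iff_alive_nonts[OF i]
    by (auto simp: simple_graph_def C chosen_cell_def inner_def)
  show "distinct (pins (chosen_spec ! i))" "set (pins (chosen_spec ! i)) \<subseteq> set (verts (chosen_spec ! i))"
    by (simp_all add: C chosen_cell_def)
  show "distinct (map fst (nonts (chosen_spec ! i)))"
    using d by (simp add: C chosen_cell_def comp_def case_prod_unfold)
  show "nonterminals (chosen_spec ! i) \<subseteq> set (verts (chosen_spec ! i)) - set (pins (chosen_spec ! i))"
    using alive_iff_alive_nonts[OF i] unfolding C nonterminals_chosen_cell by (auto simp: chosen_cell_def)
  have "j < i \<and> ns = []" if "(x, j, ns) \<in> set (nonts (chosen_spec ! i))" for x j ns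
    using that nontD(1)[OF i] by (auto simp: C chosen_cell_def alive_nonts_def)
  moreover have "pins (chosen_spec ! j) = []" if "j < i" for j
    using that i by (simp add: chosen_spec_def chosen_cell_def)
  moreover have "neighbours (chosen_spec ! i) x = {}" for x
    by (simp add: C chosen_cell_def neighbours_def)
  ultimately show "\<forall>(x, j, ns)\<in>set (nonts (chosen_spec ! i)). j < i \<and> distinct ns \<and>
      length ns = length (pins (chosen_spec ! j)) \<and>
      set ns = neighbours (chosen_spec ! i) x \<and> set ns \<subseteq> terminals (chosen_spec ! i)"
    by fastforce
qed

text \<open>Restricted to alive cells, because a dead one holds the dummy vertex. The nonterminals
  left out have dead types and would contribute nothing.\<close>

lemma verts_upto_chosen_spec:
  "i < length \<Gamma> \<Longrightarrow> alive \<Gamma> i \<Longrightarrow> verts_upto chosen_spec i = chosen_upto \<Gamma> i"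
proof (induction i rule: less_induct)
  case (less i)
  have C: "chosen_spec ! i = chosen_cell i" using less.prems by (simp add: chosen_spec_def)
  have p: "pins (chosen_spec ! j) = []" if "j < i" for j
    using that less.prems by (simp add: chosen_spec_def chosen_cell_def)
  have g: "graft x [] [] = (\<lambda>(\<pi>, v). (x # \<pi>, v))" for x by auto
  have "fst ` set (alive_nonts i) \<subseteq> nonterminals (\<Gamma> ! i)"
    by (auto simp: alive_nonts_def nonterminals_def image_iff)
  moreover have "set (chosen \<Gamma> i) \<inter> nonterminals (\<Gamma> ! i) = {}"
    using chosen_subset[OF less.prems(1)] by (auto simp: inner_def)
  moreover have "nonterminals (chosen_spec ! i) = fst ` set (alive_nonts i)"
    by (simp add: C nonterminals_chosen_cell)
  moreover have "set (verts (chosen_spec ! i)) = set (chosen \<Gamma> i) \<union> fst ` set (alive_nonts i)"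
    using less.prems(2) by (simp add: C chosen_cell_def)
  ultimately have T: "terminals (chosen_spec ! i) = set (chosen \<Gamma> i)"
    by (auto simp: terminals_def)
  have *: "(if j < i then graft x (pins (chosen_spec ! j)) [] ` verts_upto chosen_spec j else {}) =
      (if j < i then (\<lambda>(\<pi>, v). (x # \<pi>, v)) ` chosen_upto \<Gamma> j else {})"
    if "alive \<Gamma> j" for x j
    using that less.IH[of j] less.prems(1) by (simp add: p g)
  have nonts: "nonts (chosen_cell i) = map (\<lambda>(x, j, ns). (x, j, [])) (alive_nonts i)"
    by (simp add: chosen_cell_def)
  have "verts_upto chosen_spec i = Pair [] ` set (chosen \<Gamma> i) \<union>
      (\<Union>(x, j, ns)\<in>set (alive_nonts i). if j < i then (\<lambda>(\<pi>, v). (x # \<pi>, v)) ` chosen_upto \<Gamma> j else {})"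
    by (subst verts_upto.simps, unfold T, unfold C nonts set_map image_image)
      (intro arg_cong2[where f = union] SUP_cong refl,
        use * in \<open>auto simp: alive_nonts_def simp del: graft.simps\<close>)
  also have "\<dots> = chosen_upto \<Gamma> i"
  proof -
    define f where "f = (\<lambda>(x, j, ns :: nat list).
      if j < i then (\<lambda>(\<pi>, v). (x # \<pi>, v)) ` chosen_upto \<Gamma> j else {})"
    have "f t = {}" if "t \<in> set (nonts (\<Gamma> ! i)) - set (alive_nonts i)" for t
      using that less.prems(1) chosen_upto_dead by (auto simp: f_def alive_nonts_def split: if_splits)
    moreover have "set (alive_nonts i) \<subseteq> set (nonts (\<Gamma> ! i))"
      by (auto simp: alive_nonts_def)
    ultimately have "(\<Union>t\<in>set (alive_nonts i). f t) = (\<Union>t\<in>set (nonts (\<Gamma> ! i)). f t)"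
      by blast
    then show ?thesis unfolding chosen_upto.simps[of \<Gamma> i] f_def by simp
  qed
  finally show ?case .
qed

text \<open>The last cell has no open pins, so its labelling is membership in \<open>V\<close> and
  the sum over pins in \<open>count_edges_upto\<close> is empty. The \<open>cut_size\<close> many
  bichromatic edges and at most as many monochromatic ones make up the whole multiset.\<close>

lemma chosen_spec_correct:
  defines "V \<equiv> expansion_verts chosen_spec"
  shows "V \<subseteq> expansion_verts \<Gamma>"
    and "cut_size \<Gamma> (length \<Gamma> - 1) = crossing (expansion_edges \<Gamma>) V (expansion_verts \<Gamma> - V)"
    and "max_cut (expansion_verts \<Gamma>) (expansion_edges \<Gamma>) \<le> 2 * cut_size \<Gamma> (length \<Gamma> - 1)"
proof -
  define n where "n = length \<Gamma> - 1"
  have ne: "\<Gamma> \<noteq> []" using hier by (simp add: hier_spec_def)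
  then have i: "n < length \<Gamma>" by (simp add: n_def)
  have o: "open_pins \<Gamma> n = []" using ne by (simp add: open_pins_def n_def)
  have V: "V = chosen_upto \<Gamma> n"
    using verts_upto_chosen_spec[OF i alive_if_no_open_pins[OF i o]]
    by (simp add: V_def expansion_verts_def chosen_spec_def n_def)
  then show sub: "V \<subseteq> expansion_verts \<Gamma>"
    using chosen_upto_subset[OF i] by (simp add: expansion_verts_def n_def)
  have l: "labelling \<Gamma> n l = (\<lambda>y. y \<in> V)" for l
    using o by (simp add: labelling_def V fun_eq_iff)
  obtain U where U: "U \<le> cut_size \<Gamma> n"
    and eq: "\<And>b. size {#e \<in># expansion_edges \<Gamma>. bichromatic (\<lambda>y. y \<in> V) e = b#} =
      (if b then cut_size \<Gamma> n else U)"
    using count_edges_upto[OF i] unfolding expansion_edges_def n_def[symmetric] by (auto simp: o l)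
  have "crossing (expansion_edges \<Gamma>) V (expansion_verts \<Gamma> - V) =
      size {#e \<in># expansion_edges \<Gamma>. bichromatic (\<lambda>y. y \<in> V) e = True#}"
    unfolding crossing_def
  proof (intro arg_cong[where f = size] filter_mset_cong refl)
    fix e assume "e \<in># expansion_edges \<Gamma>"
    then obtain u v where "u \<in> expansion_verts \<Gamma>" "v \<in> expansion_verts \<Gamma>" "e = {u, v}"
      unfolding expansion_edges_def expansion_verts_def by (blast dest: edges_upto_verts)
    with sub show "(\<exists>u\<in>V. \<exists>v\<in>expansion_verts \<Gamma> - V. e = {u, v}) = (bichromatic (\<lambda>y. y \<in> V) e = True)"
      by (auto simp: bichromatic_edge doubleton_eq_iff)
  qed
  with eq[of True] show "cut_size \<Gamma> (length \<Gamma> - 1) = crossing (expansion_edges \<Gamma>) V (expansion_verts \<Gamma> - V)"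
    by (simp add: n_def)
  have "size (expansion_edges \<Gamma>) =
      size {#e \<in># expansion_edges \<Gamma>. bichromatic (\<lambda>y. y \<in> V) e#} +
      size {#e \<in># expansion_edges \<Gamma>. \<not> bichromatic (\<lambda>y. y \<in> V) e#}"
    by (metis multiset_partition size_union)
  then have "size (expansion_edges \<Gamma>) = cut_size \<Gamma> n + U"
    using eq[of True] eq[of False] by simp
  with U max_cut_le_size[of "expansion_verts \<Gamma>" "expansion_edges \<Gamma>"]
  show "max_cut (expansion_verts \<Gamma>) (expansion_edges \<Gamma>) \<le> 2 * cut_size \<Gamma> (length \<Gamma> - 1)"
    by (simp add: n_def)
qed

end


section \<open>Reasoning about programs\<close>

text \<open>The time is passed on as an integer, on which the simplifier computes with numerals rather
  than with iterated \<open>Suc\<close>.\<close>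

definition wp :: "prog \<Rightarrow> state \<Rightarrow> (int \<Rightarrow> state \<Rightarrow> bool) \<Rightarrow> bool" where
  "wp p s Q \<longleftrightarrow> (\<exists>t s'. exec p s t s' \<and> Q (int t) s')"

inductive_cases exec_SeqE: "exec (Seq p q) s t s'"
inductive_cases exec_CondE: "exec (Cond e p q) s t s'"

text \<open>Execution has to be simplified from the start: otherwise the simplifier would first expand
  the postcondition for an arbitrary state.\<close>

lemma wp_cong [cong]: "s = s' \<Longrightarrow> wp p s Q = wp p s' Q"
  by simp

text \<open>Determinism turns \<open>wp\<close> from an existence statement into a value; thus the
  rules for commands are equations, and straight-line code is run by rewriting.\<close>

lemma wp_exec: "exec p s t s' \<Longrightarrow> wp p s Q = Q (int t) s'"
  unfolding wp_def by (blast dest: exec_deterministic)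

lemma wp_simps [simp]:
  "wp (Assign r e) s Q = Q (int (cost e + 1)) (s\<lparr>regs := (regs s)(r := val e s)\<rparr>)"
  "wp (Store a e e') s Q = Q (int (cost e + cost e' + 1))
     (s\<lparr>arrs := (arrs s)(a := (arrs s a)(val e s := val e' s))\<rparr>)"
  "wp (Read r) s Q = Q 1
     (s\<lparr>regs := (regs s)(r := (case inp s of [] \<Rightarrow> 0 | k # _ \<Rightarrow> k)), inp := tl (inp s)\<rparr>)"
  "wp (Write e) s Q = Q (int (cost e + 1)) (s\<lparr>outp := outp s @ [val e s]\<rparr>)"
  "wp (Seq p q) s Q = wp p s (\<lambda>t s'. wp q s' (\<lambda>t'. Q (t + t')))"
proof -
  show "wp (Seq p q) s Q = wp p s (\<lambda>t s'. wp q s' (\<lambda>t'. Q (t + t')))"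
  proof
    assume "wp (Seq p q) s Q"
    then show "wp p s (\<lambda>t s'. wp q s' (\<lambda>t'. Q (t + t')))"
      unfolding wp_def by (fastforce elim: exec_SeqE)
  next
    assume "wp p s (\<lambda>t s'. wp q s' (\<lambda>t'. Q (t + t')))"
    then show "wp (Seq p q) s Q"
      unfolding wp_def by (metis exec.Seq of_nat_add)
  qed
qed (rule wp_exec[OF exec.Assign] wp_exec[OF exec.Store] wp_exec[OF exec.Write]
    wp_exec[OF exec.Read, unfolded of_nat_1])+

lemma wp_Cond [simp]:
  "wp (Cond e p q) s Q =
     (if val e s \<noteq> 0 then wp p s (\<lambda>t. Q (int (cost e + 1) + t))
      else wp q s (\<lambda>t. Q (int (cost e + 1) + t)))"
proof
  assume "wp (Cond e p q) s Q"
  then obtain t s' where exec: "exec (Cond e p q) s t s'" and Q: "Q (int t) s'"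
    unfolding wp_def by blast
  from exec show "if val e s \<noteq> 0 then wp p s (\<lambda>t. Q (int (cost e + 1) + t))
      else wp q s (\<lambda>t. Q (int (cost e + 1) + t))"
    by (rule exec_CondE) (use Q in \<open>simp_all add: wp_exec add.assoc\<close>)
next
  assume "if val e s \<noteq> 0 then wp p s (\<lambda>t. Q (int (cost e + 1) + t))
      else wp q s (\<lambda>t. Q (int (cost e + 1) + t))"
  then show "wp (Cond e p q) s Q"
    unfolding wp_def by (metis exec.CondTrue exec.CondFalse of_nat_add)
qed

lemma wp_conseq: "wp p s R \<Longrightarrow> (\<And>t s'. R t s' \<Longrightarrow> Q t s') \<Longrightarrow> wp p s Q"
  unfolding wp_def by blast

text \<open>Each loop of the program works through a list known to the proof. The invariant refers
  to the part \<open>ys\<close> done and the part \<open>zs\<close> to come, so induction on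
  \<open>zs\<close> yields termination and the time bound together. A round costs at most
  \<open>B x\<close> plus one test, and one more test ends the loop.\<close>

lemma wp_While_foreach:
  fixes B :: "'a \<Rightarrow> int"
  assumes "I [] xs s"
    and step: "\<And>ys x zs s. xs = ys @ x # zs \<Longrightarrow> I ys (x # zs) s \<Longrightarrow>
      val e s \<noteq> 0 \<and> wp p s (\<lambda>t s'. t \<le> B x \<and> I (ys @ [x]) zs s')"
    and stop: "\<And>s. I xs [] s \<Longrightarrow> val e s = 0"
    and post: "\<And>(t :: int) s'. t \<le> (\<Sum>x\<leftarrow>xs. B x + cost e + 1) + cost e + 1 \<Longrightarrow> I xs [] s' \<Longrightarrow> Q t s'"
  shows "wp (While e p) s Q"
proof -
  have "wp (While e p) s (\<lambda>t s'. t \<le> (\<Sum>x\<leftarrow>zs. B x + cost e + 1) + cost e + 1 \<and> I xs [] s')"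
    if "xs = ys @ zs" "I ys zs s" for ys zs s
    using that
  proof (induction zs arbitrary: ys s)
    case Nil
    then have "exec (While e p) s (cost e + 1) s" by (intro exec.WhileFalse stop) simp
    with Nil show ?case by (simp add: wp_exec)
  next
    case (Cons x zs)
    from step[OF Cons.prems] obtain t s' where
      1: "val e s \<noteq> 0" "exec p s t s'" "t \<le> B x" "I (ys @ [x]) zs s'"
      unfolding wp_def by blast
    from Cons.IH[OF _ 1(4)] Cons.prems(1) obtain t' s'' where
      2: "exec (While e p) s' t' s''" "t' \<le> (\<Sum>x\<leftarrow>zs. B x + cost e + 1) + cost e + 1" "I xs [] s''"
      unfolding wp_def by auto
    from exec.WhileTrue[OF 1(1,2) 2(1)] 1(3) 2(2,3) show ?case by (simp add: wp_exec)
  qed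
  from this[of "[]" xs s] assms(1) post show ?thesis by (auto elim: wp_conseq)
qed

text \<open>The tapes are left out; each rule states its effect on them explicitly.\<close>

definition frame :: "nat set \<Rightarrow> nat set \<Rightarrow> state \<Rightarrow> state \<Rightarrow> bool" where
  "frame R A s s' \<longleftrightarrow>
     (\<forall>r. r \<notin> R \<longrightarrow> regs s' r = regs s r) \<and> (\<forall>a. a \<notin> A \<longrightarrow> arrs s' a = arrs s a)"

lemma frame_arrs: "frame R A s s' \<Longrightarrow> a \<notin> A \<Longrightarrow> arrs s' a = arrs s a"
  by (simp add: frame_def)

abbreviation seqs :: "prog \<Rightarrow> prog \<Rightarrow> prog" (infixr ";;" 60) where
  "p ;; q \<equiv> Seq p q"

abbreviation increment :: "nat \<Rightarrow> prog" where
  "increment r \<equiv> Assign r (Plus (Reg r) (Num 1))"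

abbreviation decrement :: "nat \<Rightarrow> prog" where
  "decrement r \<equiv> Assign r (Minus (Reg r) (Num 1))"


section \<open>A linear time program\<close>

abbreviation (input) "rCells \<equiv> 2 :: nat"
abbreviation (input) "rIndex \<equiv> 3 :: nat"
abbreviation (input) "rPos \<equiv> 4 :: nat"
abbreviation (input) "rCount \<equiv> 5 :: nat"
abbreviation (input) "rCount' \<equiv> 6 :: nat"
abbreviation (input) "rV \<equiv> 7 :: nat"
abbreviation (input) "rU \<equiv> 8 :: nat"
abbreviation (input) "rVerts \<equiv> 9 :: nat"
abbreviation (input) "rUsed \<equiv> 10 :: nat"
abbreviation (input) "rPins \<equiv> 11 :: nat"
abbreviation (input) "rNonts \<equiv> 12 :: nat"
abbreviation (input) "rChosen \<equiv> 13 :: nat"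
abbreviation (input) "rCut \<equiv> 14 :: nat"
abbreviation (input) "rFree \<equiv> 15 :: nat"
abbreviation (input) "rBase \<equiv> 16 :: nat"
abbreviation (input) "rSlot \<equiv> 17 :: nat"
abbreviation (input) "rType \<equiv> 18 :: nat"

text \<open>Index spaces: vertex names for \<open>aTrue\<close>, \<open>aFalse\<close>,
  \<open>aMark\<close>, \<open>aHead\<close>; list positions for \<open>aVerts\<close>,
  \<open>aPins\<close>, \<open>aNonts\<close>, \<open>aTypes\<close>, \<open>aChosen\<close>; cell
  indices for \<open>aCut\<close>, \<open>aAlive\<close>, \<open>aBase\<close>; edge slots for
  \<open>aTarget\<close>, \<open>aNext\<close>; pin slots for \<open>aPinTrue\<close>,
  \<open>aPinFalse\<close>, where the pins of a cell occupy a block whose start is its entry in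
  \<open>aBase\<close>.\<close>

abbreviation (input) "aVerts \<equiv> 2 :: nat"
abbreviation (input) "aTrue \<equiv> 3 :: nat"
abbreviation (input) "aFalse \<equiv> 4 :: nat"
abbreviation (input) "aMark \<equiv> 5 :: nat"
abbreviation (input) "aHead \<equiv> 6 :: nat"
abbreviation (input) "aTarget \<equiv> 7 :: nat"
abbreviation (input) "aNext \<equiv> 8 :: nat"
abbreviation (input) "aPins \<equiv> 9 :: nat"
abbreviation (input) "aNonts \<equiv> 10 :: nat"
abbreviation (input) "aTypes \<equiv> 11 :: nat"
abbreviation (input) "aChosen \<equiv> 12 :: nat"
abbreviation (input) "aCut \<equiv> 13 :: nat"
abbreviation (input) "aAlive \<equiv> 14 :: nat"
abbreviation (input) "aBase \<equiv> 15 :: nat"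
abbreviation (input) "aPinTrue \<equiv> 16 :: nat"
abbreviation (input) "aPinFalse \<equiv> 17 :: nat"

section \<open>Reading a cell\<close>

definition read_verts :: prog where
  "read_verts =
     Read rVerts ;; Assign rPos (Num 0) ;;
     While (Minus (Reg rVerts) (Reg rPos))
       (Read rV ;; Store aVerts (Reg rPos) (Reg rV) ;;
        Store aTrue (Reg rV) (Num 0) ;; Store aFalse (Reg rV) (Num 0) ;;
        Store aMark (Reg rV) (Num 0) ;; Store aHead (Reg rV) (Num 0) ;; increment rPos)"

text \<open>Vertex names recur in different cells, so the entries of earlier cells must be cleared.
  Clearing just the listed names keeps this linear in the cell, however large the names are.\<close>

lemma wp_read_verts:
  assumes inp: "inp s = encode_list (\<lambda>v. [v]) vs @ rest"
    and post: "\<And>(t :: int) s'. t \<le> 40 * length vs + 10 \<Longrightarrow> inp s' = rest \<Longrightarrow> outp s' = outp s \<Longrightarrow>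
      frame {rVerts, rPos, rV} {aVerts, aTrue, aFalse, aMark, aHead} s s' \<Longrightarrow>
      regs s' rVerts = length vs \<Longrightarrow> \<forall>k<length vs. arrs s' aVerts k = vs ! k \<Longrightarrow>
      \<forall>v\<in>set vs. arrs s' aTrue v = 0 \<and> arrs s' aFalse v = 0 \<and> arrs s' aMark v = 0 \<and>
        arrs s' aHead v = 0 \<Longrightarrow> Q t s'"
  shows "wp read_verts s Q"
  unfolding read_verts_def wp_simps
proof (rule wp_While_foreach[where xs = vs and B = "\<lambda>_. 30" and I = "\<lambda>ys zs s'.
    inp s' = zs @ rest \<and> outp s' = outp s \<and>
    frame {rVerts, rPos, rV} {aVerts, aTrue, aFalse, aMark, aHead} s s' \<and>
    regs s' rVerts = length vs \<and> regs s' rPos = length ys \<and>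
    (\<forall>k<length ys. arrs s' aVerts k = ys ! k) \<and>
    (\<forall>v\<in>set ys. arrs s' aTrue v = 0 \<and> arrs s' aFalse v = 0 \<and> arrs s' aMark v = 0 \<and>
        arrs s' aHead v = 0)"], goal_cases)
  case 1
  then show ?case using inp by (simp add: encode_list_def frame_def)
next
  case (2 ys x zs s)
  then show ?case by (auto simp: frame_def nth_append less_Suc_eq)
next
  case (4 t s')
  then show ?case by (intro post) (auto simp: sum_list_triv)
qed simp

text \<open>Adjacency lists are linked lists whose slots are never reused; a slot points to an older one,
  so that inserting an edge does not affect existing lists.\<close>

fun chain :: "(nat \<Rightarrow> nat) \<Rightarrow> (nat \<Rightarrow> nat) \<Rightarrow> nat \<Rightarrow> nat list \<Rightarrow> bool" where
  "chain nx tg k [] \<longleftrightarrow> k = 0"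
| "chain nx tg k (x # xs) \<longleftrightarrow> k \<noteq> 0 \<and> tg k = x \<and> nx k < k \<and> chain nx tg (nx k) xs"

lemma chain_upd:
  "chain nx tg k xs \<Longrightarrow> k < m \<Longrightarrow> chain (nx(m := a)) (tg(m := b)) k xs"
  by (induction nx tg k xs rule: chain.induct) auto

definition read_edges :: prog where
  "read_edges =
     Read rCount ;;
     While (Reg rCount)
       (Read rU ;; Read rV ;;
        increment rUsed ;; Store aTarget (Reg rUsed) (Reg rV) ;;
        Store aNext (Reg rUsed) (Arr aHead (Reg rU)) ;; Store aHead (Reg rU) (Reg rUsed) ;;
        increment rUsed ;; Store aTarget (Reg rUsed) (Reg rU) ;;
        Store aNext (Reg rUsed) (Arr aHead (Reg rV)) ;; Store aHead (Reg rV) (Reg rUsed) ;;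
        decrement rCount)"

lemma wp_read_edges:
  assumes inp: "inp s = encode_list (\<lambda>(u, v). [u, v]) es @ rest"
    and head: "\<forall>v\<in>V. arrs s aHead v = 0"
    and es: "\<forall>(u, v)\<in>set es. u \<in> V \<and> v \<in> V"
    and post: "\<And>(t :: int) s'. t \<le> 60 * length es + 10 \<Longrightarrow> inp s' = rest \<Longrightarrow> outp s' = outp s \<Longrightarrow>
      frame {rCount, rU, rV, rUsed} {aTarget, aNext, aHead} s s' \<Longrightarrow>
      \<forall>v\<in>V. chain (arrs s' aNext) (arrs s' aTarget) (arrs s' aHead v) (adj (rev es) v) \<Longrightarrow> Q t s'"
  shows "wp read_edges s Q"
  unfolding read_edges_def wp_simps
proof (rule wp_While_foreach[where xs = es and B = "\<lambda>_. 50" and I = "\<lambda>ys zs s'.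
    inp s' = concat (map (\<lambda>(u, v). [u, v]) zs) @ rest \<and> outp s' = outp s \<and>
    frame {rCount, rU, rV, rUsed} {aTarget, aNext, aHead} s s' \<and>
    regs s' rCount = length zs \<and>
    (\<forall>v\<in>V. arrs s' aHead v \<le> regs s' rUsed \<and>
      chain (arrs s' aNext) (arrs s' aTarget) (arrs s' aHead v) (adj (rev ys) v))"], goal_cases)
  case 1
  then show ?case using inp head by (simp add: encode_list_def frame_def)
next
  case (2 ys x zs s')
  obtain u v where x: "x = (u, v)" by fastforce
  from 2 es have V: "u \<in> V" "v \<in> V" by (auto simp: x)
  define k where "k = regs s' rUsed"
  have le: "arrs s' aHead w \<le> k" and ch: "chain ((arrs s' aNext)(Suc k := a, Suc (Suc k) := a'))
      ((arrs s' aTarget)(Suc k := b, Suc (Suc k) := b')) (arrs s' aHead w) (adj (rev ys) w)"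
    if "w \<in> V" for w a a' b b'
    using 2 that by (auto simp: k_def intro!: chain_upd le_imp_less_Suc le_SucI)
  have lt: "arrs s' aHead w < Suc k" if "w \<in> V" for w
    using le[OF that] by simp
  have k: "regs s' rUsed = k" by (simp add: k_def)
  from 2 have st: "frame {rCount, rU, rV, rUsed} {aTarget, aNext, aHead} s s'"
    "outp s' = outp s" "inp s' = u # v # concat (map (\<lambda>(u, v). [u, v]) zs) @ rest"
    "regs s' rCount = Suc (length zs)"
    by (auto simp: x)
  show ?case
    unfolding x
  \<comment> \<open>Stating the end of a round explicitly separates running the code from
    maintaining the lists. If \<open>u = v\<close>, the second insertion already sees the first
    one.\<close>
  proof (intro conjI, use st in simp, rule wp_conseq[where R = "\<lambda>t s''. t \<le> 50 \<and> s'' = s'\<lparr>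
      inp := concat (map (\<lambda>(u, v). [u, v]) zs) @ rest,
      arrs := (arrs s')
        (aTarget := (arrs s' aTarget)(Suc k := v, Suc (Suc k) := u),
         aNext := (arrs s' aNext)(Suc k := arrs s' aHead u,
            Suc (Suc k) := if u = v then Suc k else arrs s' aHead v),
         aHead := (arrs s' aHead)(u := Suc k, v := Suc (Suc k))),
      regs := (regs s')(rU := u, rV := v, rUsed := Suc (Suc k), rCount := length zs)\<rparr>"],
      goal_cases)
    case 1
    then show ?case using st by (simp add: k)
  next
    case (2 t s'')
    then show ?case using st V lt by (auto simp: frame_def ch le le_SucI less_SucI)
  qed
next
  case (4 t s')
  then show ?case by (intro post) (auto simp: sum_list_triv)
qed simp

text \<open>\<open>rCells\<close> counts the unfinished cells including this one, so
  \<open>rCells - 1\<close> vanishes exactly in the last cell. There the pins are skipped, as in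
  \<open>open_pins\<close>; the assignment in that branch changes nothing.\<close>

definition read_pins :: prog where
  "read_pins =
     Read rCount ;; Assign rPins (Num 0) ;;
     While (Reg rCount)
       (Read rV ;;
        Cond (Minus (Reg rCells) (Num 1))
          (Store aPins (Reg rPins) (Reg rV) ;; Store aMark (Reg rV) (Num 1) ;; increment rPins)
          (Assign rPins (Num 0)) ;;
        decrement rCount)"

lemma wp_read_pins:
  fixes s :: state and ps :: "nat list"
  defines "qs \<equiv> if regs s rCells = 1 then [] else ps"
  assumes inp: "inp s = encode_list (\<lambda>v. [v]) ps @ rest" and cells: "regs s rCells \<noteq> 0"
    and post: "\<And>(t :: int) s'. t \<le> 40 * length ps + 10 \<Longrightarrow> inp s' = rest \<Longrightarrow> outp s' = outp s \<Longrightarrow>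
      frame {rCount, rPins, rV} {aPins, aMark} s s' \<Longrightarrow>
      regs s' rPins = length qs \<Longrightarrow> \<forall>k<length qs. arrs s' aPins k = qs ! k \<Longrightarrow>
      \<forall>v. arrs s' aMark v = (if v \<in> set qs then 1 else arrs s aMark v) \<Longrightarrow> Q t s'"
  shows "wp read_pins s Q"
  unfolding read_pins_def wp_simps
proof (rule wp_While_foreach[where xs = ps and B = "\<lambda>_. 30" and I = "\<lambda>ys zs s'.
    inp s' = zs @ rest \<and> outp s' = outp s \<and>
    frame {rCount, rPins, rV} {aPins, aMark} s s' \<and>
    regs s' rCount = length zs \<and>
    (let qs = if regs s rCells = 1 then [] else ys in
      regs s' rPins = length qs \<and> (\<forall>k<length qs. arrs s' aPins k = qs ! k) \<and>
      (\<forall>v. arrs s' aMark v = (if v \<in> set qs then 1 else arrs s aMark v)))"], goal_cases)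
  case 1
  then show ?case using inp by (simp add: encode_list_def frame_def)
next
  case (2 ys x zs s')
  then have "regs s' rCells = regs s rCells" by (simp add: frame_def)
  with 2 cells show ?case
    by (auto simp: frame_def Let_def nth_append less_Suc_eq split: if_splits)
next
  case (4 t s')
  then show ?case by (intro post) (auto simp: sum_list_triv qs_def Let_def)
qed simp

text \<open>Neighbours come in the order of the pins of the type, whose counts are stored
  consecutively, so advancing \<open>rBase\<close> replaces a search.\<close>

definition read_neighbours :: prog where
  "read_neighbours =
     Read rCount' ;;
     While (Reg rCount')
       (Read rV ;;
        Store aTrue (Reg rV) (Plus (Arr aTrue (Reg rV)) (Arr aPinTrue (Reg rBase))) ;;
        Store aFalse (Reg rV) (Plus (Arr aFalse (Reg rV)) (Arr aPinFalse (Reg rBase))) ;;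
        increment rBase ;; decrement rCount')"

lemma sum_nth_snoc:
  fixes f :: "nat \<Rightarrow> nat"
  shows "(\<Sum>k<Suc (length ys). if (ys @ [x]) ! k = v then f k else 0) =
   (\<Sum>k<length ys. if ys ! k = v then f k else 0) + (if x = v then f (length ys) else 0)"
  by (auto simp: nth_append intro!: sum.cong)

lemma wp_read_neighbours:
  assumes inp: "inp s = encode_list (\<lambda>v. [v]) ns @ rest"
    and post: "\<And>(t :: int) s'. t \<le> 40 * length ns + 10 \<Longrightarrow> inp s' = rest \<Longrightarrow> outp s' = outp s \<Longrightarrow>
      frame {rCount', rV, rBase} {aTrue, aFalse} s s' \<Longrightarrow>
      \<forall>v. arrs s' aTrue v = arrs s aTrue v +
        (\<Sum>k<length ns. if ns ! k = v then arrs s aPinTrue (regs s rBase + k) else 0) \<Longrightarrow>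
      \<forall>v. arrs s' aFalse v = arrs s aFalse v +
        (\<Sum>k<length ns. if ns ! k = v then arrs s aPinFalse (regs s rBase + k) else 0) \<Longrightarrow> Q t s'"
  shows "wp read_neighbours s Q"
  unfolding read_neighbours_def wp_simps
proof (rule wp_While_foreach[where xs = ns and B = "\<lambda>_. 30" and I = "\<lambda>ys zs s'.
    inp s' = zs @ rest \<and> outp s' = outp s \<and>
    frame {rCount', rV, rBase} {aTrue, aFalse} s s' \<and>
    regs s' rCount' = length zs \<and> regs s' rBase = regs s rBase + length ys \<and>
    (\<forall>v. arrs s' aTrue v = arrs s aTrue v +
        (\<Sum>k<length ys. if ys ! k = v then arrs s aPinTrue (regs s rBase + k) else 0)) \<and>
    (\<forall>v. arrs s' aFalse v = arrs s aFalse v +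
        (\<Sum>k<length ys. if ys ! k = v then arrs s aPinFalse (regs s rBase + k) else 0))"], goal_cases)
  case 1
  then show ?case using inp by (simp add: encode_list_def frame_def)
next
  case (2 ys x zs s')
  then show ?case
    by (auto simp: frame_def sum_nth_snoc simp del: sum.lessThan_Suc)
next
  case (4 t s')
  then show ?case by (intro post) (auto simp: sum_list_triv)
qed simp

text \<open>Pins and nonterminals share the mark, both being passed over by the colouring.
  \<open>rCut\<close> starts from the cuts inside the copies. The assignment to \<open>rV\<close>
  only fills a branch, in place of an empty command.\<close>

definition read_nonts :: prog where
  "read_nonts =
     Read rCount ;; Assign rNonts (Num 0) ;; Assign rCut (Num 0) ;;
     While (Reg rCount)
       (Read rU ;; Read rType ;; Store aMark (Reg rU) (Num 1) ;;
        Assign rCut (Plus (Reg rCut) (Arr aCut (Reg rType))) ;;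
        Cond (Arr aAlive (Reg rType))
          (Store aNonts (Reg rNonts) (Reg rU) ;; Store aTypes (Reg rNonts) (Reg rType) ;;
           increment rNonts)
          (Assign rV (Num 0)) ;;
        Assign rBase (Arr aBase (Reg rType)) ;; read_neighbours ;; decrement rCount)"

fun encode_nont :: "nat \<times> nat \<times> nat list \<Rightarrow> nat list" where
  "encode_nont (x, j, ns) = x # j # encode_list (\<lambda>v. [v]) ns"

lemma wp_read_nonts:
  fixes s :: state and ts :: "(nat \<times> nat \<times> nat list) list"
  defines "us \<equiv> filter (\<lambda>(x, j, ns). arrs s aAlive j \<noteq> 0) ts"
  assumes inp: "inp s = encode_list encode_nont ts @ rest"
    and post: "\<And>(t :: int) s'. t \<le> (\<Sum>(x, j, ns)\<leftarrow>ts. 40 * int (length ns) + 80) + 20 \<Longrightarrow>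
      inp s' = rest \<Longrightarrow> outp s' = outp s \<Longrightarrow>
      frame {rCount, rNonts, rCut, rU, rType, rV, rBase, rCount'}
        {aMark, aNonts, aTypes, aTrue, aFalse} s s' \<Longrightarrow>
      regs s' rNonts = length us \<Longrightarrow>
      \<forall>k<length us. arrs s' aNonts k = fst (us ! k) \<and> arrs s' aTypes k = fst (snd (us ! k)) \<Longrightarrow>
      regs s' rCut = (\<Sum>(x, j, ns)\<leftarrow>ts. arrs s aCut j) \<Longrightarrow>
      \<forall>v. arrs s' aMark v = (if v \<in> fst ` set ts then 1 else arrs s aMark v) \<Longrightarrow>
      \<forall>v. arrs s' aTrue v = arrs s aTrue v + (\<Sum>(x, j, ns)\<leftarrow>ts.
        \<Sum>k<length ns. if ns ! k = v then arrs s aPinTrue (arrs s aBase j + k) else 0) \<Longrightarrow>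
      \<forall>v. arrs s' aFalse v = arrs s aFalse v + (\<Sum>(x, j, ns)\<leftarrow>ts.
        \<Sum>k<length ns. if ns ! k = v then arrs s aPinFalse (arrs s aBase j + k) else 0) \<Longrightarrow>
      Q t s'"
  shows "wp read_nonts s Q"
  unfolding read_nonts_def wp_simps(1-4) wp_simps(5)[of "Read _"] wp_simps(5)[of "Assign _ _"]
proof (rule wp_While_foreach[where xs = ts and B = "\<lambda>(x, j, ns). 40 * int (length ns) + 70" and I = "\<lambda>ys zs s'.
    inp s' = concat (map encode_nont zs) @ rest \<and> outp s' = outp s \<and>
    frame {rCount, rNonts, rCut, rU, rType, rV, rBase, rCount'}
      {aMark, aNonts, aTypes, aTrue, aFalse} s s' \<and>
    regs s' rCount = length zs \<and>
    (let us = filter (\<lambda>(x, j, ns). arrs s aAlive j \<noteq> 0) ys in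
     regs s' rNonts = length us \<and>
     (\<forall>k<length us. arrs s' aNonts k = fst (us ! k) \<and> arrs s' aTypes k = fst (snd (us ! k)))) \<and>
    regs s' rCut = (\<Sum>(x, j, ns)\<leftarrow>ys. arrs s aCut j) \<and>
    (\<forall>v. arrs s' aMark v = (if v \<in> fst ` set ys then 1 else arrs s aMark v)) \<and>
    (\<forall>v. arrs s' aTrue v = arrs s aTrue v + (\<Sum>(x, j, ns)\<leftarrow>ys.
        \<Sum>k<length ns. if ns ! k = v then arrs s aPinTrue (arrs s aBase j + k) else 0)) \<and>
    (\<forall>v. arrs s' aFalse v = arrs s aFalse v + (\<Sum>(x, j, ns)\<leftarrow>ys.
        \<Sum>k<length ns. if ns ! k = v then arrs s aPinFalse (arrs s aBase j + k) else 0))"], goal_cases)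
  case 1
  then show ?case using inp by (simp add: encode_list_def frame_def)
next
  case (2 ys x zs s')
  obtain u j ns where x: "x = (u, j, ns)" by (cases x)
  from 2 have fr: "frame {rCount, rNonts, rCut, rU, rType, rV, rBase, rCount'}
      {aMark, aNonts, aTypes, aTrue, aFalse} s s'" by blast
  from 2 show ?case
    unfolding x
  proof (simp add: frame_arrs[OF fr], intro conjI impI, goal_cases)
    case 1
    then show ?case
      by (intro wp_read_neighbours[where ns = ns and rest = "concat (map encode_nont zs) @ rest"])
        (auto simp: frame_def Let_def nth_append less_Suc_eq cong: if_cong)
  next
    case 2
    then show ?case
      by (intro wp_read_neighbours[where ns = ns and rest = "concat (map encode_nont zs) @ rest"])
        (auto simp: frame_def Let_def cong: if_cong)
  qed
next
  case (4 t s')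
  have "(\<Sum>x\<leftarrow>ts. (case x of (x, j, ns) \<Rightarrow> 40 * int (length ns) + 70) + cost (Reg rCount) + 1) \<le>
      (\<Sum>(x, j, ns)\<leftarrow>ts. 40 * int (length ns) + 80)"
    by (rule sum_list_mono) auto
  with 4 show ?case by (intro post) (auto simp: us_def Let_def)
qed simp

section \<open>The greedy loop\<close>

definition push :: "nat \<Rightarrow> prog" where
  "push a =
     Assign rSlot (Arr aHead (Reg rU)) ;;
     While (Reg rSlot)
       (Store a (Arr aTarget (Reg rSlot)) (Plus (Arr a (Arr aTarget (Reg rSlot))) (Num 1)) ;;
        Assign rSlot (Arr aNext (Reg rSlot)))"

lemma wp_push:
  assumes ch: "chain (arrs s aNext) (arrs s aTarget) (arrs s aHead (regs s rU)) xs"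
    and a: "a \<notin> {aNext, aTarget, aHead}"
    and post: "\<And>(t :: int) s'. t \<le> 20 * length xs + 10 \<Longrightarrow> inp s' = inp s \<Longrightarrow> outp s' = outp s \<Longrightarrow>
      frame {rSlot} {a} s s' \<Longrightarrow> \<forall>v. arrs s' a v = arrs s a v + count_list xs v \<Longrightarrow> Q t s'"
  shows "wp (push a) s Q"
  unfolding push_def wp_simps
proof (rule wp_While_foreach[where xs = xs and B = "\<lambda>_. 15" and I = "\<lambda>ys zs s'.
    inp s' = inp s \<and> outp s' = outp s \<and> frame {rSlot} {a} s s' \<and>
    chain (arrs s aNext) (arrs s aTarget) (regs s' rSlot) zs \<and>
    (\<forall>v. arrs s' a v = arrs s a v + count_list ys v)"], goal_cases)
  case 1
  then show ?case using ch by (simp add: frame_def)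
next
  case (2 ys x zs s')
  with a have "arrs s' aNext = arrs s aNext" "arrs s' aTarget = arrs s aTarget"
    by (auto simp: frame_def)
  with 2 a show ?case by (auto simp: frame_def)
next
  case (4 t s')
  then show ?case by (intro post) (auto simp: sum_list_triv)
qed simp

text \<open>Truncated subtraction serves as comparison: it is nonzero iff strictly more edges lead
  to \<open>V\<^sub>1\<close> than to \<open>V\<^sub>2\<close>, and then the vertex goes to
  \<open>V\<^sub>2\<close>, in accordance with \<open>c\<close> in
  \<open>greedy_step\<close>.\<close>

definition colour_verts :: prog where
  "colour_verts =
     Assign rPos (Num 0) ;; Assign rChosen (Num 0) ;;
     While (Minus (Reg rVerts) (Reg rPos))
       (Assign rU (Arr aVerts (Reg rPos)) ;; increment rPos ;;
        Cond (Arr aMark (Reg rU))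
          (Assign rSlot (Num 0))
          (Cond (Minus (Arr aTrue (Reg rU)) (Arr aFalse (Reg rU)))
            (Assign rCut (Plus (Reg rCut) (Arr aTrue (Reg rU))) ;; push aFalse)
            (Assign rCut (Plus (Reg rCut) (Arr aFalse (Reg rU))) ;;
             Store aChosen (Reg rChosen) (Reg rU) ;; increment rChosen ;; push aTrue)))"

lemma wp_colour_verts:
  fixes s :: state and vs :: "nat list"
  defines "us \<equiv> filter (\<lambda>v. arrs s aMark v = 0) vs"
  assumes vs: "regs s rVerts = length vs" "\<forall>k<length vs. arrs s aVerts k = vs ! k"
    and ch: "\<forall>v\<in>set vs. chain (arrs s aNext) (arrs s aTarget) (arrs s aHead v) (nb v)"
    and A: "\<forall>v\<in>set vs. arrs s aTrue v = A True v \<and> arrs s aFalse v = A False v"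
    and fold: "fold (greedy_step nb) us ([], A, regs s rCut) = (S', A', E')"
    and post: "\<And>(t :: int) s'. t \<le> (\<Sum>v\<leftarrow>vs. 20 * int (length (nb v)) + 80) + 20 \<Longrightarrow>
      inp s' = inp s \<Longrightarrow> outp s' = outp s \<Longrightarrow>
      frame {rPos, rChosen, rU, rSlot, rCut} {aTrue, aFalse, aChosen} s s' \<Longrightarrow>
      regs s' rChosen = length S' \<Longrightarrow> \<forall>k<length S'. arrs s' aChosen k = S' ! k \<Longrightarrow>
      regs s' rCut = E' \<Longrightarrow>
      \<forall>v\<in>set vs. arrs s' aTrue v = A' True v \<and> arrs s' aFalse v = A' False v \<Longrightarrow> Q t s'"
  shows "wp colour_verts s Q"
proof -
  let ?fold = "\<lambda>ys. fold (greedy_step nb) (filter (\<lambda>v. arrs s aMark v = 0) ys) ([], A, regs s rCut)"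
  let ?J = "\<lambda>(S, B, E) s'.
    regs s' rChosen = length S \<and> (\<forall>k<length S. arrs s' aChosen k = S ! k) \<and>
    regs s' rCut = E \<and> (\<forall>v\<in>set vs. arrs s' aTrue v = B True v \<and> arrs s' aFalse v = B False v)"
  let ?fr = "\<lambda>s'. inp s' = inp s \<and> outp s' = outp s \<and>
    frame {rPos, rChosen, rU, rSlot, rCut} {aTrue, aFalse, aChosen} s s'"
  show ?thesis
    unfolding colour_verts_def wp_simps(1) wp_simps(5)[of "Assign _ _"]
  proof (rule wp_While_foreach[where xs = vs and B = "\<lambda>v. 20 * int (length (nb v)) + 70"
      and I = "\<lambda>ys zs s'. ?fr s' \<and> regs s' rPos = length ys \<and> ?J (?fold ys) s'"], goal_cases)
    case 1
    then show ?case using A by (simp add: frame_def)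
  next
    case (2 ys u zs s')
    obtain S B E where f: "?fold ys = (S, B, E)" by (metis prod_cases3)
    from 2 f have fr: "?fr s'" and pos: "regs s' rPos = length ys" and J: "?J (S, B, E) s'"
      by simp_all
    from fr have same: "regs s' rVerts = length vs" "arrs s' aVerts = arrs s aVerts"
      "arrs s' aMark = arrs s aMark" "arrs s' aNext = arrs s aNext"
      "arrs s' aTarget = arrs s aTarget" "arrs s' aHead = arrs s aHead"
      using vs by (simp_all add: frame_def)
    have u: "u \<in> set vs" "arrs s aVerts (length ys) = u" "length ys < length vs"
      using 2(1) vs(2) by auto
    have chu: "chain (arrs s aNext) (arrs s aTarget) (arrs s aHead u) (nb u)"
      using ch u(1) by blast
    have Bu: "arrs s' aTrue u = B True u" "arrs s' aFalse u = B False u" using J u(1) by auto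
    consider (skip) "arrs s aMark u \<noteq> 0"
      | (false) "arrs s aMark u = 0" "\<not> B True u \<le> B False u"
      | (true) "arrs s aMark u = 0" "B True u \<le> B False u" by blast
    then show ?case
    proof cases
      case skip
      then show ?thesis
        using fr pos J u(3) by (auto simp: same u(1,2) f frame_def)
    next
      case false
      have "?fold (ys @ [u]) = (S, B(False := \<lambda>w. B False w + count_list (nb u) w), E + B True u)"
        using false f by simp
      then show ?thesis
        using false pos u(3)
        by (simp add: same u(1,2) Bu, intro wp_push[where xs = "nb u"])
          (use fr J chu in \<open>auto simp: same frame_def\<close>)
    next
      case true
      have "?fold (ys @ [u]) = (S @ [u], B(True := \<lambda>w. B True w + count_list (nb u) w), E + B False u)"
        using true f by simp
      then show ?thesis
        using true pos u(3)
        by (simp add: same u(1,2) Bu, intro wp_push[where xs = "nb u"])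
          (use fr J chu in \<open>auto simp: same frame_def nth_append less_Suc_eq\<close>)
    qed
  next
    case (3 s')
    then show ?case using vs by (auto simp: frame_def)
  next
    case (4 t s')
    have "(\<Sum>v\<leftarrow>vs. 20 * int (length (nb v)) + 70 + int (cost (Minus (Reg rVerts) (Reg rPos))) + 1) \<le>
        (\<Sum>v\<leftarrow>vs. 20 * int (length (nb v)) + 80)"
      by (rule sum_list_mono) simp
    with 4 show ?case using fold by (intro post) (auto simp: us_def)
  qed
qed

section \<open>Storing the results for a cell and writing the output\<close>

definition store_pins :: prog where
  "store_pins =
     Store aBase (Reg rIndex) (Reg rFree) ;; Store aCut (Reg rIndex) (Reg rCut) ;;
     Assign rPos (Num 0) ;;
     While (Minus (Reg rPins) (Reg rPos))
       (Assign rU (Arr aPins (Reg rPos)) ;;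
        Store aPinTrue (Reg rFree) (Arr aTrue (Reg rU)) ;;
        Store aPinFalse (Reg rFree) (Arr aFalse (Reg rU)) ;;
        increment rFree ;; increment rPos)"

text \<open>Blocks are only appended at \<open>rFree\<close>; the clause on smaller indices protects
  those of earlier cells.\<close>

lemma wp_store_pins:
  assumes ps: "regs s rPins = length ps" "\<forall>k<length ps. arrs s aPins k = ps ! k"
    and post: "\<And>(t :: int) s'. t \<le> 40 * length ps + 20 \<Longrightarrow> inp s' = inp s \<Longrightarrow> outp s' = outp s \<Longrightarrow>
      frame {rPos, rU, rFree} {aBase, aCut, aPinTrue, aPinFalse} s s' \<Longrightarrow>
      regs s' rFree = regs s rFree + length ps \<Longrightarrow>
      \<forall>j. arrs s' aBase j = (if j = regs s rIndex then regs s rFree else arrs s aBase j) \<Longrightarrow>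
      \<forall>j. arrs s' aCut j = (if j = regs s rIndex then regs s rCut else arrs s aCut j) \<Longrightarrow>
      \<forall>k<regs s rFree. arrs s' aPinTrue k = arrs s aPinTrue k \<and>
        arrs s' aPinFalse k = arrs s aPinFalse k \<Longrightarrow>
      \<forall>k<length ps. arrs s' aPinTrue (regs s rFree + k) = arrs s aTrue (ps ! k) \<and>
        arrs s' aPinFalse (regs s rFree + k) = arrs s aFalse (ps ! k) \<Longrightarrow> Q t s'"
  shows "wp store_pins s Q"
  unfolding store_pins_def wp_simps
proof (rule wp_While_foreach[where xs = ps and B = "\<lambda>_. 30" and I = "\<lambda>ys zs s'.
      inp s' = inp s \<and> outp s' = outp s \<and>
      frame {rPos, rU, rFree} {aBase, aCut, aPinTrue, aPinFalse} s s' \<and>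
      regs s' rPos = length ys \<and> regs s' rFree = regs s rFree + length ys \<and>
      (\<forall>j. arrs s' aBase j = (if j = regs s rIndex then regs s rFree else arrs s aBase j)) \<and>
      (\<forall>j. arrs s' aCut j = (if j = regs s rIndex then regs s rCut else arrs s aCut j)) \<and>
      (\<forall>k<regs s rFree. arrs s' aPinTrue k = arrs s aPinTrue k \<and>
        arrs s' aPinFalse k = arrs s aPinFalse k) \<and>
      (\<forall>k<length ys. arrs s' aPinTrue (regs s rFree + k) = arrs s aTrue (ys ! k) \<and>
        arrs s' aPinFalse (regs s rFree + k) = arrs s aFalse (ys ! k))"], goal_cases)
  case 1
  then show ?case by (simp add: frame_def)
next
  case (2 ys p zs s')
  then have same: "regs s' rPins = length ps" "arrs s' aPins (length ys) = p"
    "arrs s' aTrue = arrs s aTrue" "arrs s' aFalse = arrs s aFalse" "length ys < length ps"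
    using ps by (auto simp: frame_def)
  with 2 show ?case by (auto simp: same frame_def nth_append less_Suc_eq)
next
  case (3 s')
  then show ?case using ps by (auto simp: frame_def)
next
  case (4 t s')
  then show ?case by (intro post) (auto simp: sum_list_triv)
qed

definition write_array :: "nat \<Rightarrow> nat \<Rightarrow> prog" where
  "write_array a r =
     Assign rPos (Num 0) ;;
     While (Minus (Reg r) (Reg rPos)) (Write (Arr a (Reg rPos)) ;; increment rPos)"

lemma wp_write_array:
  assumes xs: "regs s r = length xs" "\<forall>k<length xs. arrs s a k = xs ! k" and r: "r \<noteq> rPos"
    and post: "\<And>(t :: int) s'. t \<le> 20 * length xs + 10 \<Longrightarrow> inp s' = inp s \<Longrightarrow> outp s' = outp s @ xs \<Longrightarrow>
      frame {rPos} {} s s' \<Longrightarrow> Q t s'"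
  shows "wp (write_array a r) s Q"
  unfolding write_array_def wp_simps
proof (rule wp_While_foreach[where xs = xs and B = "\<lambda>_. 10" and I = "\<lambda>ys zs s'.
      inp s' = inp s \<and> outp s' = outp s @ ys \<and> frame {rPos} {} s s' \<and>
      regs s' rPos = length ys"], goal_cases)
  case 1
  then show ?case by (simp add: frame_def)
next
  case (2 ys p zs s')
  then have "regs s' r = length xs" "arrs s' a (length ys) = p" "length ys < length xs"
    using xs r by (auto simp: frame_def)
  with 2 show ?case by (auto simp: frame_def)
next
  case (3 s')
  then show ?case using xs r by (auto simp: frame_def)
next
  case (4 t s')
  then show ?case by (intro post) (auto simp: sum_list_triv)
qed

definition write_nonts :: prog where
  "write_nonts =
     Write (Reg rNonts) ;; Assign rPos (Num 0) ;;
     While (Minus (Reg rNonts) (Reg rPos))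
       (Write (Arr aNonts (Reg rPos)) ;; Write (Arr aTypes (Reg rPos)) ;; Write (Num 0) ;;
        increment rPos)"

lemma wp_write_nonts:
  fixes us :: "(nat \<times> nat \<times> nat list) list"
  assumes us: "regs s rNonts = length us"
      "\<forall>k<length us. arrs s aNonts k = fst (us ! k) \<and> arrs s aTypes k = fst (snd (us ! k))"
    and post: "\<And>(t :: int) s'. t \<le> 30 * length us + 10 \<Longrightarrow> inp s' = inp s \<Longrightarrow>
      outp s' = outp s @ encode_list encode_nont (map (\<lambda>(x, j, ns). (x, j, [])) us) \<Longrightarrow>
      frame {rPos} {} s s' \<Longrightarrow> Q t s'"
  shows "wp write_nonts s Q"
  unfolding write_nonts_def wp_simps
proof (rule wp_While_foreach[where xs = us and B = "\<lambda>_. 20" and I = "\<lambda>ys zs s'.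
      inp s' = inp s \<and>
      outp s' = outp s @ length us # concat (map encode_nont (map (\<lambda>(x, j, ns). (x, j, [])) ys)) \<and>
      frame {rPos} {} s s' \<and> regs s' rPos = length ys"], goal_cases)
  case 1
  then show ?case using us by (simp add: frame_def)
next
  case (2 ys p zs s')
  then have "regs s' rNonts = length us" "arrs s' aNonts (length ys) = fst p"
    "arrs s' aTypes (length ys) = fst (snd p)" "length ys < length us"
    using us by (auto simp: frame_def)
  with 2 show ?case by (auto simp: frame_def encode_list_def split: prod.split)
next
  case (3 s')
  then show ?case using us by (auto simp: frame_def)
next
  case (4 t s')
  then show ?case by (intro post) (auto simp: sum_list_triv encode_list_def)
qed

text \<open>The vertex list consists of two arrays under one length; the two zeros are the empty
  lists of edges and pins. A dead cell has neither chosen vertices nor kept nonterminals, and its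
  array of chosen vertices is made to hold the dummy.\<close>

definition write_cell :: prog where
  "write_cell =
     Cond (Plus (Reg rChosen) (Reg rNonts))
       (Store aAlive (Reg rIndex) (Num 1))
       (Store aAlive (Reg rIndex) (Num 0) ;; Store aChosen (Num 0) (Num 0) ;;
        Assign rChosen (Num 1)) ;;
     Write (Plus (Reg rChosen) (Reg rNonts)) ;;
     write_array aChosen rChosen ;; write_array aNonts rNonts ;;
     Write (Num 0) ;; Write (Num 0) ;; write_nonts"

lemma encode_cell_eq:
  "encode_cell C = encode_list (\<lambda>v. [v]) (verts C) @ encode_list (\<lambda>(u, v). [u, v]) (edges C) @
     encode_list (\<lambda>v. [v]) (pins C) @ encode_list encode_nont (nonts C)"
proof -
  have "encode_nont = (\<lambda>(x, j, ns). x # j # encode_list (\<lambda>v. [v]) ns)" by auto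
  then show ?thesis by (simp add: encode_cell_def)
qed

lemma wp_write_cell:
  fixes us :: "(nat \<times> nat \<times> nat list) list"
  assumes us: "regs s rNonts = length us"
      "\<forall>k<length us. arrs s aNonts k = fst (us ! k) \<and> arrs s aTypes k = fst (snd (us ! k))"
    and S: "regs s rChosen = length S" "\<forall>k<length S. arrs s aChosen k = S ! k"
    and al: "al \<longleftrightarrow> S \<noteq> [] \<or> us \<noteq> []"
    and post: "\<And>(t :: int) s'. t \<le> 20 * length S + 60 * length us + 100 \<Longrightarrow> inp s' = inp s \<Longrightarrow>
      outp s' = outp s @ encode_cell \<lparr>verts = (if al then S @ map fst us else [0]), edges = [],
        pins = [], nonts = map (\<lambda>(x, j, ns). (x, j, [])) us\<rparr> \<Longrightarrow>
      frame {rPos, rChosen} {aAlive, aChosen} s s' \<Longrightarrow>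
      \<forall>j. arrs s' aAlive j = (if j = regs s rIndex then of_bool al else arrs s aAlive j) \<Longrightarrow> Q t s'"
  shows "wp write_cell s Q"
proof -
  \<comment> \<open>\<open>T\<close> covers the dummy too: \<open>us\<close> is empty in a dead
    cell, so the vertices written are \<open>T @ map fst us\<close> in both cases.\<close>
  define T where "T = (if al then S else [0])"
  have T: "int (length T) \<le> int (length S) + 1" by (simp add: T_def)
  have "wp (Cond (Plus (Reg rChosen) (Reg rNonts))
       (Store aAlive (Reg rIndex) (Num 1))
       (Store aAlive (Reg rIndex) (Num 0) ;; Store aChosen (Num 0) (Num 0) ;;
        Assign rChosen (Num 1))) s (\<lambda>t s'. t \<le> 20 \<and> inp s' = inp s \<and> outp s' = outp s \<and>
      frame {rChosen} {aAlive, aChosen} s s' \<and>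
      (\<forall>j. arrs s' aAlive j = (if j = regs s rIndex then of_bool al else arrs s aAlive j)) \<and>
      regs s' rChosen = length T \<and> (\<forall>k<length T. arrs s' aChosen k = T ! k))"
    using us(1) S al by (auto simp: T_def frame_def)
  then show ?thesis
    unfolding write_cell_def wp_simps(5)
  proof (rule wp_conseq, goal_cases)
    case c: (1 t s1)
    have us1: "regs s1 rNonts = length (map fst us)" "\<forall>k<length us. arrs s1 aNonts k = map fst us ! k"
      "\<forall>k<length us. arrs s1 aNonts k = fst (us ! k) \<and> arrs s1 aTypes k = fst (snd (us ! k))"
      using c us by (auto simp: frame_def)
    show ?case
      unfolding wp_simps(4)
    proof (rule wp_write_array[where xs = T], goal_cases)
      case w: (4 t2 s2)
      show ?case
      proof (rule wp_write_array[where xs = "map fst us"], goal_cases)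
        case w2: (4 t3 s3)
        show ?case
          unfolding wp_simps
        proof (rule wp_write_nonts[where us = us], goal_cases)
          case w3: (3 t4 s4)
          show ?case
          proof (rule post, goal_cases)
            case 1
            then show ?case using c w(1) w2(1) w3(1) T by simp
          next
            case 2
            then show ?case using c w(2) w2(2) w3(2) by simp
          next
            case 3
            then show ?case using c w(3) w2(3) w3(3) us1 al
              by (auto simp: encode_cell_eq encode_list_def T_def concat_map_singleton)
          next
            case 4
            then show ?case using c w(4) w2(4) w3(4) by (auto simp: frame_def)
          next
            case 5
            then show ?case using c w(4) w2(4) w3(4) by (auto simp: frame_def)
          qed
        qed (use us1 w(4) w2(4) in \<open>auto simp: frame_def\<close>)
      qed (use us1 w(4) in \<open>auto simp: frame_def\<close>)
    qed (use c in auto)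
  qed
qed

definition process_cell :: prog where
  "process_cell =
     read_verts ;; read_edges ;; read_pins ;; read_nonts ;; colour_verts ;; store_pins ;;
     write_cell ;; increment rIndex ;; decrement rCells"

definition approximate_max_cut :: prog where
  "approximate_max_cut =
     Read rCells ;; Write (Reg rCells) ;; While (Reg rCells) process_cell ;; Write (Reg rCut)"

section \<open>Total lengths of adjacency and neighbour lists\<close>

lemma sum_length_adj:
  assumes "distinct vs"
  shows "(\<Sum>v\<leftarrow>vs. length (adj es v)) \<le> 2 * length es"
proof -
  have "(\<Sum>v\<in>set vs. length (adj es v)) \<le> 2 * length es"
  proof (induction es)
    case (Cons e es)
    obtain a b where e: "e = (a, b)" by fastforce
    have "(\<Sum>v\<in>set vs. length (adj (e # es) v)) =
        (\<Sum>v\<in>set vs. (if v = b then 1 else 0) + (if v = a then 1 else 0) + length (adj es v))"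
      by (rule sum.cong) (auto simp: e)
    also have "\<dots> \<le> 2 + (\<Sum>v\<in>set vs. length (adj es v))"
      by (simp add: sum.distrib)
    finally show ?case using Cons by simp
  qed simp
  then show ?thesis using assms by (simp add: sum_list_distinct_conv_sum_set)
qed

text \<open>\<open>N\<close> stands for the nonterminals. Their neighbours lie outside
  \<open>N\<close>, so an edge reveals which endpoint is the nonterminal, and edges of different
  nonterminals differ.\<close>

lemma distinct_incident_edges:
  "distinct (map fst ts) \<Longrightarrow>
    \<forall>(x, j, ns)\<in>set ts. distinct ns \<and> x \<in> N \<and> set ns \<inter> N = {} \<Longrightarrow>
    distinct (concat (map (\<lambda>(x, j, ns). map (\<lambda>w. {x, w}) ns) ts))"
proof (induction ts)
  case (Cons t ts)
  obtain x j ns where t: "t = (x, j, ns)" by (cases t)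
  have x: "distinct ns" "x \<in> N" "set ns \<inter> N = {}" using Cons.prems(2) by (auto simp: t)
  have "{x, w} \<noteq> {x', w'}" if "w \<in> set ns" "(x', j', ns') \<in> set ts" "w' \<in> set ns'" for w x' j' ns' w'
  proof -
    have "w' \<notin> N" using Cons.prems(2) that(2,3) by auto
    moreover have "x \<noteq> x'" using Cons.prems(1) that(2) by (force simp: t)
    ultimately show ?thesis using x(2) by (auto simp: doubleton_eq_iff)
  qed
  then have "set (map (\<lambda>w. {x, w}) ns) \<inter>
      set (concat (map (\<lambda>(x, j, ns). map (\<lambda>w. {x, w}) ns) ts)) = {}"
    by auto
  moreover have "distinct (map (\<lambda>w. {x, w}) ns)"
    using x(1) by (auto simp: distinct_map inj_on_def doubleton_eq_iff)
  moreover have "distinct (concat (map (\<lambda>(x, j, ns). map (\<lambda>w. {x, w}) ns) ts))"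
    using Cons.prems by (intro Cons.IH) auto
  ultimately show ?case by (simp add: t)
qed simp

lemma length_le_if_distinct:
  assumes "distinct xs" "set xs \<subseteq> set ys"
  shows "length xs \<le> length ys"
proof -
  have "length xs = card (set xs)" using assms(1) by (simp add: distinct_card)
  also have "\<dots> \<le> card (set ys)" using assms(2) by (simp add: card_mono)
  also have "\<dots> \<le> length ys" by (rule card_length)
  finally show ?thesis .
qed

context simple_hierarchy
begin

text \<open>The neighbour lists do not count in the size of a specification. They are paid for by
  the edges that join nonterminals to their neighbours, no two of which coincide.\<close>

lemma sum_length_neighbours:
  assumes "i < length \<Gamma>"
  shows "(\<Sum>(x, j, ns)\<leftarrow>nonts (\<Gamma> ! i). length ns) \<le> length (edges (\<Gamma> ! i))"
proof -
  let ?L = "concat (map (\<lambda>(x, j, ns). map (\<lambda>w. {x, w}) ns) (nonts (\<Gamma> ! i)))"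
  have "distinct ?L"
    by (rule distinct_incident_edges[OF cellD(9)[OF assms], of "nonterminals (\<Gamma> ! i)"])
      (use nontD(2,5)[OF assms] in \<open>force simp: terminals_def nonterminals_def\<close>)
  moreover have "set ?L \<subseteq> set (map (\<lambda>(u, v). {u, v}) (edges (\<Gamma> ! i)))"
  proof
    fix e assume "e \<in> set ?L"
    then obtain x j ns w where t: "(x, j, ns) \<in> set (nonts (\<Gamma> ! i))" "w \<in> set ns" "e = {x, w}"
      by auto
    then have "(w, x) \<in> set (edges (\<Gamma> ! i)) \<or> (x, w) \<in> set (edges (\<Gamma> ! i))"
      using nontD(4)[OF assms t(1)] by (simp add: neighbours_def)
    then show "e \<in> set (map (\<lambda>(u, v). {u, v}) (edges (\<Gamma> ! i)))"
      using t(3) by (auto simp: image_iff insert_commute)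
  qed
  ultimately have "length ?L \<le> length (map (\<lambda>(u, v). {u, v}) (edges (\<Gamma> ! i)))"
    by (rule length_le_if_distinct)
  then show ?thesis
    by (simp add: length_concat comp_def case_prod_unfold)
qed

lemma length_pins: "i < length \<Gamma> \<Longrightarrow> length (pins (\<Gamma> ! i)) \<le> length (verts (\<Gamma> ! i))"
  using cellD(7,8)[of i] by (intro length_le_if_distinct)

lemma length_nonts: "i < length \<Gamma> \<Longrightarrow> length (nonts (\<Gamma> ! i)) \<le> length (verts (\<Gamma> ! i))"
  using cellD(9,10)[of i] length_le_if_distinct[of "map fst (nonts (\<Gamma> ! i))" "verts (\<Gamma> ! i)"]
  by (auto simp: nonterminals_def)

lemma length_chosen: "i < length \<Gamma> \<Longrightarrow> length (chosen \<Gamma> i) \<le> length (verts (\<Gamma> ! i))"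
  using distinct_chosen[of i] chosen_subset[of i]
  by (intro length_le_if_distinct) (auto simp: inner_def)

text \<open>What later cells may look up about the cells below \<open>i\<close>. The bound by
  \<open>rFree\<close> keeps their blocks out of the area where new ones are appended.\<close>

definition tables :: "nat \<Rightarrow> state \<Rightarrow> bool" where
  "tables i s \<longleftrightarrow> (\<forall>j<i.
     arrs s aCut j = cut_size \<Gamma> j \<and> arrs s aAlive j = of_bool (alive \<Gamma> j) \<and>
     arrs s aBase j + length (open_pins \<Gamma> j) \<le> regs s rFree \<and>
     (\<forall>k<length (open_pins \<Gamma> j).
       arrs s aPinTrue (arrs s aBase j + k) = degrees \<Gamma> j True (open_pins \<Gamma> j ! k) \<and>
       arrs s aPinFalse (arrs s aBase j + k) = degrees \<Gamma> j False (open_pins \<Gamma> j ! k)))"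

lemma degrees_below_tables:
  assumes i: "i < length \<Gamma>"
    and tab: "\<And>j k. j < i \<Longrightarrow> k < length (open_pins \<Gamma> j) \<Longrightarrow>
      D (base j + k) = degrees \<Gamma> j b (open_pins \<Gamma> j ! k)"
  shows "(\<Sum>(x, j, ns)\<leftarrow>nonts (\<Gamma> ! i). \<Sum>k<length ns. if ns ! k = v then D (base j + k) else 0) =
    degrees_below \<Gamma> i b v"
  unfolding degrees_below_def
proof (intro arg_cong[where f = sum_list] map_cong refl, clarify)
  fix x j ns assume "(x, j, ns) \<in> set (nonts (\<Gamma> ! i))"
  note n = nontD[OF i this]
  show "(\<Sum>k<length ns. if ns ! k = v then D (base j + k) else 0) =
      (\<Sum>k<length ns. if ns ! k = v then degrees \<Gamma> j b (pins (\<Gamma> ! j) ! k) else 0)"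
    using tab[OF n(1)] n(3) by (intro sum.cong) (simp_all add: open_pins_below[OF n(1) i])
qed

lemma wp_process_cell:
  assumes i: "i < length \<Gamma>"
    and inp: "inp s = encode_cell (\<Gamma> ! i) @ rest"
    and regs: "regs s rIndex = i" "regs s rCells = length \<Gamma> - i"
    and tab: "tables i s"
    and post: "\<And>(t :: int) s'. t \<le> 600 * (length (verts (\<Gamma> ! i)) + length (edges (\<Gamma> ! i))) \<Longrightarrow>
      inp s' = rest \<Longrightarrow> outp s' = outp s @ encode_cell (chosen_cell i) \<Longrightarrow>
      regs s' rIndex = Suc i \<Longrightarrow> regs s' rCells = length \<Gamma> - Suc i \<Longrightarrow>
      regs s' rCut = cut_size \<Gamma> i \<Longrightarrow> tables (Suc i) s' \<Longrightarrow> Q t s'"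
  shows "wp process_cell s Q"
proof -
  let ?C = "\<Gamma> ! i"
  let ?nb = "adj (rev (edges ?C))"
  have inp: "inp s = encode_list (\<lambda>v. [v]) (verts ?C) @ encode_list (\<lambda>(u, v). [u, v]) (edges ?C) @
     encode_list (\<lambda>v. [v]) (pins ?C) @ encode_list encode_nont (nonts ?C) @ rest"
    using inp by (simp add: encode_cell_eq)
  show ?thesis
    unfolding process_cell_def wp_simps(5)
  proof (rule wp_read_verts[OF inp], goal_cases)
    case a: (1 t1 s1)
    show ?case
    proof (rule wp_read_edges[OF a(2), where V = "set (verts ?C)"], goal_cases)
      case 1
      then show ?case using a(7) by blast
    next
      case 2
      then show ?case using cellD(3,4)[OF i] by auto
    next
      case b: (3 t2 s2)
      have c2: "regs s2 rCells = length \<Gamma> - i" using a(4) b(4) regs by (simp add: frame_def)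
      \<comment> \<open>\<open>rCells\<close> is 1 exactly in the last cell, where
        \<open>open_pins\<close> is empty by definition.\<close>
      have op: "(if regs s2 rCells = 1 then [] else pins ?C) = open_pins \<Gamma> i"
        using i by (auto simp: c2 open_pins_def)
      show ?case
      proof (rule wp_read_pins[OF b(2)], goal_cases)
        case 1
        then show ?case using c2 i by simp
      next
        case c: (2 t3 s3)
        note c = c[unfolded op]
        show ?case
        proof (rule wp_read_nonts[OF c(2)], goal_cases)
          case d: (1 t4 s4)
          have tab3: "tables i s3"
            using tab a(4) b(4) c(4) by (simp add: tables_def frame_def)
          have us: "filter (\<lambda>(x, j, ns). arrs s3 aAlive j \<noteq> 0) (nonts ?C) = alive_nonts i"
            unfolding alive_nonts_def using tab3 nontD(1)[OF i]
            by (intro filter_cong) (auto simp: tables_def)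
          note d = d[unfolded us]
          have cut4: "regs s4 rCut = (\<Sum>(x, j, ns)\<leftarrow>nonts ?C. cut_size \<Gamma> j)"
            unfolding d(7) using tab3 nontD(1)[OF i]
            by (intro arg_cong[where f = sum_list] map_cong refl) (auto simp: tables_def)
          have A: "\<forall>v\<in>set (verts ?C). arrs s4 aTrue v = degrees_below \<Gamma> i True v \<and>
              arrs s4 aFalse v = degrees_below \<Gamma> i False v"
          proof
            fix v assume "v \<in> set (verts ?C)"
            then have "arrs s3 aTrue v = 0" "arrs s3 aFalse v = 0"
              using a(7) b(4) c(4) by (simp_all add: frame_def)
            then show "arrs s4 aTrue v = degrees_below \<Gamma> i True v \<and>
                arrs s4 aFalse v = degrees_below \<Gamma> i False v"
              using d(9,10) tab3 degrees_below_tables[OF i, of "arrs s3 aPinTrue" "arrs s3 aBase"]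
                degrees_below_tables[OF i, of "arrs s3 aPinFalse" "arrs s3 aBase"]
              by (simp add: tables_def)
          qed
          have inner: "filter (\<lambda>v. arrs s4 aMark v = 0) (verts ?C) = inner \<Gamma> i"
            unfolding inner_def
          proof (rule filter_cong[OF refl])
            fix v assume "v \<in> set (verts ?C)"
            then have "arrs s2 aMark v = 0" using a(7) b(4) by (simp add: frame_def)
            then show "(arrs s4 aMark v = 0) =
                (v \<notin> nonterminals ?C \<and> v \<notin> set (open_pins \<Gamma> i))"
              using d(8) c(7) by (auto simp: nonterminals_def)
          qed
          have vs4: "regs s4 rVerts = length (verts ?C)"
            "\<forall>k<length (verts ?C). arrs s4 aVerts k = verts ?C ! k"
            using a(5,6) b(4) c(4) d(4) by (simp_all add: frame_def)
          have ch4: "\<forall>v\<in>set (verts ?C). chain (arrs s4 aNext) (arrs s4 aTarget) (arrs s4 aHead v) (?nb v)"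
            using b(5) c(4) d(4) by (simp add: frame_def)
          have fold4: "fold (greedy_step ?nb) (filter (\<lambda>v. arrs s4 aMark v = 0) (verts ?C))
              ([], degrees_below \<Gamma> i, regs s4 rCut) = (chosen \<Gamma> i, degrees \<Gamma> i, cut_size \<Gamma> i)"
            unfolding inner cut4 by (rule colour_eq[OF i])
          show ?case
          proof (rule wp_colour_verts[OF vs4 ch4 A fold4], goal_cases)
            case e: (1 t5 s5)
            have ps: "regs s5 rPins = length (open_pins \<Gamma> i)"
              "\<forall>k<length (open_pins \<Gamma> i). arrs s5 aPins k = open_pins \<Gamma> i ! k"
              using c(5,6) d(4) e(4) by (simp_all add: frame_def)
            show ?case
            proof (rule wp_store_pins[OF ps], goal_cases)
              case f: (1 t6 s6)
              have us6: "regs s6 rNonts = length (alive_nonts i)"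
                "\<forall>k<length (alive_nonts i). arrs s6 aNonts k = fst (alive_nonts i ! k) \<and>
                  arrs s6 aTypes k = fst (snd (alive_nonts i ! k))"
                using d(5,6) e(4) f(4) by (simp_all add: frame_def)
              have S6: "regs s6 rChosen = length (chosen \<Gamma> i)"
                "\<forall>k<length (chosen \<Gamma> i). arrs s6 aChosen k = chosen \<Gamma> i ! k"
                using e(5,6) f(4) by (simp_all add: frame_def)
              show ?case
              proof (rule wp_write_cell[OF us6 S6 alive_iff_alive_nonts[OF i]], goal_cases)
                case g: (1 t7 s7)
                have idx: "regs s5 rIndex = i" "regs s6 rIndex = i" "regs s7 rIndex = i"
                  "regs s7 rCells = length \<Gamma> - i"
                  using regs a(4) b(4) c(4) d(4) e(4) f(4) g(4) by (simp_all add: frame_def)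
                have tab5: "tables i s5"
                  using tab3 d(4) e(4) by (simp add: tables_def frame_def)
                have "tables (Suc i) s7"
                  unfolding tables_def
                proof (intro allI impI, goal_cases)
                  case (1 j)
                  have same: "arrs s7 aCut = arrs s6 aCut" "arrs s7 aBase = arrs s6 aBase"
                    "arrs s7 aPinTrue = arrs s6 aPinTrue" "arrs s7 aPinFalse = arrs s6 aPinFalse"
                    "arrs s6 aAlive = arrs s5 aAlive" "regs s7 rFree = regs s6 rFree"
                    using f(4) g(4) by (simp_all add: frame_def)
                  show ?case
                  proof (cases "j = i")
                    case True
                    have "open_pins \<Gamma> i ! k \<in> set (verts ?C)" if "k < length (open_pins \<Gamma> i)" for k
                      using that open_pins_subset[of i] cellD(8)[OF i] nth_mem by blast
                    then show ?thesis
                      using True e(7,8) f(5-9) g(5) by (auto simp: same idx)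
                  next
                    case False
                    with 1 have "j < i" by simp
                    note tj = tab5[unfolded tables_def, rule_format, OF this]
                    \<comment> \<open>An old block lies below \<open>rFree\<close>, where
                      \<open>store_pins\<close> changes nothing.\<close>
                    have "arrs s5 aBase j + k < regs s5 rFree" if "k < length (open_pins \<Gamma> j)" for k
                      using tj that by linarith
                    then show ?thesis
                      using False tj f(5-8) g(5) by (auto simp: same idx)
                  qed
                qed
                then have tab7: "tables (Suc i) (s7\<lparr>regs := (regs s7)(rIndex := Suc i, rCells := length \<Gamma> - Suc i)\<rparr>)"
                  by (simp add: tables_def)
                have "chosen_cell i = \<lparr>verts = (if alive \<Gamma> i then chosen \<Gamma> i @ map fst (alive_nonts i) else [0]),
                  edges = [], pins = [], nonts = map (\<lambda>(x, j, ns). (x, j, [])) (alive_nonts i)\<rparr>"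
                  by (simp add: chosen_cell_def)
                note out7 = g(3)[folded this]
                \<comment> \<open>The parts add up to at most 360 per vertex, 140 per edge and 198
                  per cell; since a cell has a vertex, 600 per vertex or edge suffices.\<close>
                have time: "t1 + (t2 + (t3 + (t4 + (t5 + (t6 + (t7 + 8)))))) \<le>
                    600 * (int (length (verts ?C)) + int (length (edges ?C)))"
                proof -
                  have nonts: "(\<Sum>(x, j, ns)\<leftarrow>ts. 40 * int (length ns) + 80) =
                      40 * int (\<Sum>(x, j, ns)\<leftarrow>ts. length ns) + 80 * int (length ts)"
                    for ts :: "(nat \<times> nat \<times> nat list) list"
                    by (induction ts) auto
                  have verts: "(\<Sum>v\<leftarrow>vs. 20 * int (length (?nb v)) + 80) =
                      20 * int (\<Sum>v\<leftarrow>vs. length (?nb v)) + 80 * int (length vs)" for vs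
                    by (induction vs) auto
                  have "length (open_pins \<Gamma> i) \<le> length (verts ?C)"
                    "length (pins ?C) \<le> length (verts ?C)"
                    using length_pins[OF i] by (simp_all add: open_pins_def)
                  moreover have "length (alive_nonts i) \<le> length (verts ?C)"
                    using length_nonts[OF i] length_filter_le[of _ "nonts ?C"]
                    unfolding alive_nonts_def by (rule order_trans[rotated])
                  moreover have "t4 \<le> 40 * int (length (edges ?C)) + 80 * int (length (verts ?C)) + 20"
                    using d(1) sum_length_neighbours[OF i] length_nonts[OF i] unfolding nonts by simp
                  moreover have "t5 \<le> 40 * int (length (edges ?C)) + 80 * int (length (verts ?C)) + 20"
                    using e(1) sum_length_adj[OF cellD(2)[OF i], of "rev (edges ?C)"]
                    unfolding verts by simp
                  moreover have "length (chosen \<Gamma> i) \<le> length (verts ?C)"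
                    by (rule length_chosen[OF i])
                  moreover have "1 \<le> length (verts ?C)"
                    using cellD(1)[OF i] by (cases "verts ?C") auto
                  ultimately show ?thesis
                    using a(1) b(1) c(1) f(1) g(1) by simp
                qed
                have cut7: "regs s7 rCut = cut_size \<Gamma> i"
                  using e(7) f(4) g(4) by (simp add: frame_def)
                show ?case
                  unfolding wp_simps
                  by (rule post) (use time out7 tab7 cut7 idx i in
                    \<open>auto simp: a(3) b(3) c(3) d(2,3) e(2,3) f(2,3) g(2)\<close>)
              qed
            qed
          qed
        qed
      qed
    qed
  qed
qed

section \<open>Total time and output size\<close>

lemma sum_cells: "(\<Sum>i\<leftarrow>[0..<length \<Gamma>]. f (\<Gamma> ! i)) = (\<Sum>C\<leftarrow>\<Gamma>. f C)"
  by (simp add: map_nth flip: map_map[of f "(!) \<Gamma>", unfolded comp_def])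

lemma length_le_vertex_number: "length \<Gamma> \<le> vertex_number \<Gamma>"
proof -
  have "(\<Sum>C\<leftarrow>\<Gamma>. 1) \<le> (\<Sum>C\<leftarrow>\<Gamma>. length (verts C))"
    using cellD(1) by (intro sum_list_mono) (auto simp: in_set_conv_nth Suc_le_eq)
  then show ?thesis by (simp add: vertex_number_def sum_list_triv)
qed

lemma vertex_number_pos: "1 \<le> vertex_number \<Gamma>"
  using length_le_vertex_number hier by (cases \<Gamma>) (auto simp: hier_spec_def)

text \<open>\<open>rCut\<close> holds the result of the cell processed last, which after the loop is
  the cut of the whole expansion. The 20 beyond the 600 per vertex or edge cover the loop tests and
  the commands around the loop, as there are at most as many cells as vertices.\<close>

lemma wp_approximate_max_cut:
  "wp approximate_max_cut (initial (encode_spec \<Gamma>)) (\<lambda>t s'.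
     t \<le> 620 * int (vertex_number \<Gamma> + edge_number \<Gamma>) \<and>
     outp s' = encode_spec chosen_spec @ [cut_size \<Gamma> (length \<Gamma> - 1)])"
  unfolding approximate_max_cut_def wp_simps
proof (rule wp_While_foreach[where xs = "[0..<length \<Gamma>]"
    and B = "\<lambda>i. 600 * int (length (verts (\<Gamma> ! i)) + length (edges (\<Gamma> ! i)))"
    and I = "\<lambda>ys zs s. inp s = concat (map encode_cell (drop (length ys) \<Gamma>)) \<and>
      outp s = length \<Gamma> # concat (map (\<lambda>i. encode_cell (chosen_cell i)) ys) \<and>
      regs s rIndex = length ys \<and> regs s rCells = length \<Gamma> - length ys \<and>
      tables (length ys) s \<and> (ys \<noteq> [] \<longrightarrow> regs s rCut = cut_size \<Gamma> (length ys - 1))"], goal_cases)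
  case 1
  show ?case by (simp add: initial_def encode_spec_def encode_list_def tables_def)
next
  case (2 ys x zs s)
  have "length ys < length \<Gamma>" using arg_cong[OF 2(1), of length] by simp
  moreover from this have "x = length ys"
    using arg_cong[OF 2(1), of "\<lambda>xs. xs ! length ys"] by simp
  ultimately have x: "x < length \<Gamma>" "length ys = x" by simp_all
  have inp: "inp s = encode_cell (\<Gamma> ! x) @ concat (map encode_cell (drop (Suc x) \<Gamma>))"
    using 2(2) x by (simp flip: Cons_nth_drop_Suc)
  show ?case
  proof (intro conjI)
    show "val (Reg rCells) s \<noteq> 0" using 2(2) x by simp
    show "wp process_cell s (\<lambda>t s. t \<le> 600 * int (length (verts (\<Gamma> ! x)) + length (edges (\<Gamma> ! x))) \<and>
      inp s = concat (map encode_cell (drop (length (ys @ [x])) \<Gamma>)) \<and>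
      outp s = length \<Gamma> # concat (map (\<lambda>i. encode_cell (chosen_cell i)) (ys @ [x])) \<and>
      regs s rIndex = length (ys @ [x]) \<and> regs s rCells = length \<Gamma> - length (ys @ [x]) \<and>
      tables (length (ys @ [x])) s \<and>
      (ys @ [x] \<noteq> [] \<longrightarrow> regs s rCut = cut_size \<Gamma> (length (ys @ [x]) - 1)))"
      by (rule wp_process_cell[OF x(1) inp]) (use 2(2) x in auto)
  qed
next
  case (4 t s')
  have ne: "\<Gamma> \<noteq> []" using hier by (simp add: hier_spec_def)
  have "(\<Sum>i\<leftarrow>ks. 600 * int (length (verts (\<Gamma> ! i)) + length (edges (\<Gamma> ! i))) +
      int (cost (Reg rCells)) + 1) =
    600 * int (\<Sum>i\<leftarrow>ks. length (verts (\<Gamma> ! i)) + length (edges (\<Gamma> ! i))) + 2 * int (length ks)" for ks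
    by (induction ks) auto
  moreover have "(\<Sum>i\<leftarrow>[0..<length \<Gamma>]. length (verts (\<Gamma> ! i)) + length (edges (\<Gamma> ! i))) =
      vertex_number \<Gamma> + edge_number \<Gamma>"
    using sum_cells[of "\<lambda>C. length (verts C) + length (edges C)"]
    by (simp add: vertex_number_def edge_number_def sum_list_addf)
  ultimately have "t \<le> 600 * int (vertex_number \<Gamma> + edge_number \<Gamma>) + 2 * int (length \<Gamma>) + 2"
    using 4(1) by simp
  then have "t + 10 \<le> 620 * int (vertex_number \<Gamma> + edge_number \<Gamma>)"
    using length_le_vertex_number vertex_number_pos by simp
  then show ?case
    using 4(2) ne by (simp add: encode_spec_def encode_list_def chosen_spec_def comp_def)
qed simp

text \<open>An alive cell is written with four length fields, one number per chosen vertex and four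
  per kept nonterminal: one in the vertex list, then name, type and an empty list. A dummy takes
  five numbers. As a cell has at least one vertex, this gives the factor 9; the tenth pays for the
  number of cells.\<close>

lemma length_encode_chosen_spec: "length (encode_spec chosen_spec) \<le> 10 * vertex_number \<Gamma>"
proof -
  have cell: "length (encode_cell (chosen_cell i)) \<le> 9 * length (verts (\<Gamma> ! i))"
    if "i < length \<Gamma>" for i
  proof -
    have nonts: "length (concat (map encode_nont (map (\<lambda>(x, j, ns). (x, j, [])) us))) = 3 * length us"
      for us :: "(nat \<times> nat \<times> nat list) list"
      by (induction us) (auto simp: encode_list_def)
    have "length (alive_nonts i) \<le> length (verts (\<Gamma> ! i))"
      using length_nonts[OF that] length_filter_le[of _ "nonts (\<Gamma> ! i)"]
      unfolding alive_nonts_def by (rule order_trans[rotated])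
    moreover have "length (encode_list encode_nont (nonts (chosen_cell i))) = 1 + 3 * length (alive_nonts i)"
      using nonts by (simp add: chosen_cell_def encode_list_def)
    moreover have "length (encode_list (\<lambda>v. [v]) (verts (chosen_cell i))) \<le>
        2 + length (chosen \<Gamma> i) + length (alive_nonts i)"
      by (simp add: chosen_cell_def encode_list_def)
    ultimately show ?thesis
      using length_chosen[OF that] cellD(1)[OF that]
      by (cases "verts (\<Gamma> ! i)") (simp_all add: encode_cell_eq chosen_cell_def encode_list_def)
  qed
  have "(\<Sum>i\<leftarrow>[0..<length \<Gamma>]. length (encode_cell (chosen_cell i))) \<le>
      (\<Sum>i\<leftarrow>[0..<length \<Gamma>]. 9 * length (verts (\<Gamma> ! i)))"
    using cell by (intro sum_list_mono) simp
  also have "\<dots> = 9 * vertex_number \<Gamma>"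
    using sum_cells[of "\<lambda>C. 9 * length (verts C)"] by (simp add: vertex_number_def sum_list_const_mult)
  finally show ?thesis
    using vertex_number_pos
    by (simp add: encode_spec_def encode_list_def chosen_spec_def length_concat comp_def)
qed

end

theorem theorem4p6:
  shows "\<exists>(P :: prog) (c :: nat) (d :: nat). \<forall>\<Gamma> :: spec.
    hier_spec \<Gamma> \<and> simple_spec \<Gamma> \<longrightarrow>
    (\<exists>(t :: nat) (\<Delta> :: spec) (E :: nat) V\<^sub>1 V\<^sub>2.
       computes P (encode_spec \<Gamma>) t (encode_spec \<Delta> @ [E]) \<and>
       t \<le> c * (vertex_number \<Gamma> + edge_number \<Gamma>) \<and>
       V\<^sub>1 \<union> V\<^sub>2 = expansion_verts \<Gamma> \<and> V\<^sub>1 \<inter> V\<^sub>2 = {} \<and>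
       hier_spec \<Delta> \<and> expansion_verts \<Delta> = V\<^sub>1 \<and>
       length (encode_spec \<Delta>) \<le> d * vertex_number \<Gamma> \<and>
       E = crossing (expansion_edges \<Gamma>) V\<^sub>1 V\<^sub>2 \<and>
       max_cut (expansion_verts \<Gamma>) (expansion_edges \<Gamma>) \<le> 2 * E)"
proof (rule exI[of _ approximate_max_cut], rule exI[of _ 620], rule exI[of _ 10], intro allI impI)
  fix \<Gamma> :: spec
  assume "hier_spec \<Gamma> \<and> simple_spec \<Gamma>"
  then interpret simple_hierarchy \<Gamma> by unfold_locales auto
  let ?E = "cut_size \<Gamma> (length \<Gamma> - 1)" and ?V = "expansion_verts chosen_spec"
  obtain t s where "exec approximate_max_cut (initial (encode_spec \<Gamma>)) t s"
    "int t \<le> 620 * int (vertex_number \<Gamma> + edge_number \<Gamma>)"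
    "outp s = encode_spec chosen_spec @ [?E]"
    using wp_approximate_max_cut unfolding wp_def by blast
  then have "computes approximate_max_cut (encode_spec \<Gamma>) t (encode_spec chosen_spec @ [?E])"
    "t \<le> 620 * (vertex_number \<Gamma> + edge_number \<Gamma>)"
    unfolding computes_def by auto
  then show "\<exists>t \<Delta> E V\<^sub>1 V\<^sub>2.
       computes approximate_max_cut (encode_spec \<Gamma>) t (encode_spec \<Delta> @ [E]) \<and>
       t \<le> 620 * (vertex_number \<Gamma> + edge_number \<Gamma>) \<and>
       V\<^sub>1 \<union> V\<^sub>2 = expansion_verts \<Gamma> \<and> V\<^sub>1 \<inter> V\<^sub>2 = {} \<and>
       hier_spec \<Delta> \<and> expansion_verts \<Delta> = V\<^sub>1 \<and>
       length (encode_spec \<Delta>) \<le> 10 * vertex_number \<Gamma> \<and>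
       E = crossing (expansion_edges \<Gamma>) V\<^sub>1 V\<^sub>2 \<and>
       max_cut (expansion_verts \<Gamma>) (expansion_edges \<Gamma>) \<le> 2 * E"
    using chosen_spec_correct hier_chosen_spec length_encode_chosen_spec
    by (intro exI[of _ t] exI[of _ chosen_spec] exI[of _ ?E] exI[of _ ?V]
        exI[of _ "expansion_verts \<Gamma> - ?V"]) auto
qed

end
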